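(* Let $\mathbf{A}$ and $\mathbf{B}$ be strictly simple algebras (in the same language) which generate the same variety. Then either $\mathbf{A}\cong\mathbf{B}$, or both $\mathbf{A}$ and $\mathbf{B}$ are strongly abelian.
   Context: An algebra is strictly simple if it is finite, simple, and has no nontrivial proper subalgebras (every proper subalgebra has at most one element). An algebra $\mathbf{A}$ is strongly abelian if for every term $t(x,\bar y)$ and all $a,b,c$ and tuples $\bar u,\bar v,\bar w$ from $A$, $t(a,\bar u)=t(b,\bar v)$ implies $t(c,\bar u)=t(c,\bar v)$. *)

theory Defs
  imports Main
begin

text \<open>Universal algebra basics. A language is given by an arity function
  ar :: 'f => nat on operation symbols. An algebra in this language is a carrier
  set A together with an interpretation F :: 'f => 'a list => 'a, where F f is
  only meaningful on argument lists of length ar f with entries in A.\<close>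

datatype ('f, 'v) trm = Var 'v | Op 'f "('f, 'v) trm list"

fun wf_trm :: "('f \<Rightarrow> nat) \<Rightarrow> ('f, 'v) trm \<Rightarrow> bool" where
  "wf_trm ar (Var x) = True"
| "wf_trm ar (Op f ts) = (length ts = ar f \<and> (\<forall>t\<in>set ts. wf_trm ar t))"

fun eval :: "('f \<Rightarrow> 'a list \<Rightarrow> 'a) \<Rightarrow> ('v \<Rightarrow> 'a) \<Rightarrow> ('f, 'v) trm \<Rightarrow> 'a" where
  "eval F e (Var x) = e x"
| "eval F e (Op f ts) = F f (map (eval F e) ts)"

definition is_algebra :: "('f \<Rightarrow> nat) \<Rightarrow> 'a set \<Rightarrow> ('f \<Rightarrow> 'a list \<Rightarrow> 'a) \<Rightarrow> bool" where
  "is_algebra ar A F \<longleftrightarrow>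
     (\<forall>f xs. length xs = ar f \<and> set xs \<subseteq> A \<longrightarrow> F f xs \<in> A)"

definition subuniverse :: "('f \<Rightarrow> nat) \<Rightarrow> 'a set \<Rightarrow> ('f \<Rightarrow> 'a list \<Rightarrow> 'a) \<Rightarrow> 'a set \<Rightarrow> bool" where
  "subuniverse ar A F S \<longleftrightarrow> S \<subseteq> A \<and>
     (\<forall>f xs. length xs = ar f \<and> set xs \<subseteq> S \<longrightarrow> F f xs \<in> S)"

definition congruence :: "('f \<Rightarrow> nat) \<Rightarrow> 'a set \<Rightarrow> ('f \<Rightarrow> 'a list \<Rightarrow> 'a) \<Rightarrow> 'a rel \<Rightarrow> bool" where
  "congruence ar A F \<theta> \<longleftrightarrow> equiv A \<theta> \<and>
     (\<forall>f xs ys. length xs = ar f \<and> length ys = ar f \<and> set xs \<subseteq> A \<and> set ys \<subseteq> A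
        \<and> list_all2 (\<lambda>x y. (x, y) \<in> \<theta>) xs ys \<longrightarrow> (F f xs, F f ys) \<in> \<theta>)"

definition simple_alg :: "('f \<Rightarrow> nat) \<Rightarrow> 'a set \<Rightarrow> ('f \<Rightarrow> 'a list \<Rightarrow> 'a) \<Rightarrow> bool" where
  "simple_alg ar A F \<longleftrightarrow> (\<exists>x\<in>A. \<exists>y\<in>A. x \<noteq> y) \<and>
     (\<forall>\<theta>. congruence ar A F \<theta> \<longrightarrow> \<theta> = Id_on A \<or> \<theta> = A \<times> A)"

definition strictly_simple :: "('f \<Rightarrow> nat) \<Rightarrow> 'a set \<Rightarrow> ('f \<Rightarrow> 'a list \<Rightarrow> 'a) \<Rightarrow> bool" where
  "strictly_simple ar A F \<longleftrightarrow> is_algebra ar A F \<and> finite A \<and> simple_alg ar A F \<and>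
     (\<forall>S. subuniverse ar A F S \<and> S \<noteq> A \<longrightarrow> card S \<le> 1)"

text \<open>Strongly abelian: for every term t(x0, x1, ..., ) (variable 0 plays the role of x,
  the remaining variables the role of the tuple y), and all a, b, c and assignments u, v
  of the other variables in A: t(a,u) = t(b,v) implies t(c,u) = t(c,v).\<close>
definition strongly_abelian :: "('f \<Rightarrow> nat) \<Rightarrow> 'a set \<Rightarrow> ('f \<Rightarrow> 'a list \<Rightarrow> 'a) \<Rightarrow> bool" where
  "strongly_abelian ar A F \<longleftrightarrow>
     (\<forall>t :: ('f, nat) trm. \<forall>a\<in>A. \<forall>b\<in>A. \<forall>c\<in>A. \<forall>u v.
        wf_trm ar t \<and> range u \<subseteq> A \<and> range v \<subseteq> A \<and>
        eval F (u(0 := a)) t = eval F (v(0 := b)) t \<longrightarrow>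
        eval F (u(0 := c)) t = eval F (v(0 := c)) t)"

definition isomorphic_alg ::
  "('f \<Rightarrow> nat) \<Rightarrow> 'a set \<Rightarrow> ('f \<Rightarrow> 'a list \<Rightarrow> 'a) \<Rightarrow> 'b set \<Rightarrow> ('f \<Rightarrow> 'b list \<Rightarrow> 'b) \<Rightarrow> bool" where
  "isomorphic_alg ar A F B G \<longleftrightarrow> (\<exists>h. bij_betw h A B \<and>
     (\<forall>f xs. length xs = ar f \<and> set xs \<subseteq> A \<longrightarrow> h (F f xs) = G f (map h xs)))"

definition satisfies_eq ::
  "('f \<Rightarrow> nat) \<Rightarrow> 'a set \<Rightarrow> ('f \<Rightarrow> 'a list \<Rightarrow> 'a) \<Rightarrow> ('f, nat) trm \<Rightarrow> ('f, nat) trm \<Rightarrow> bool" where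
  "satisfies_eq ar A F s t \<longleftrightarrow> (\<forall>e. range e \<subseteq> A \<longrightarrow> eval F e s = eval F e t)"

text \<open>By Birkhoff's HSP theorem, V(A) = Mod(Id(A)); hence A and B generate the same
  variety iff they satisfy the same identities.\<close>
definition same_variety ::
  "('f \<Rightarrow> nat) \<Rightarrow> 'a set \<Rightarrow> ('f \<Rightarrow> 'a list \<Rightarrow> 'a) \<Rightarrow> 'b set \<Rightarrow> ('f \<Rightarrow> 'b list \<Rightarrow> 'b) \<Rightarrow> bool" where
  "same_variety ar A F B G \<longleftrightarrow>
     (\<forall>s t. wf_trm ar s \<and> wf_trm ar t \<longrightarrow> (satisfies_eq ar A F s t \<longleftrightarrow> satisfies_eq ar B G s t))"

end

theory Submission
  imports Defs "HOL-Library.FuncSet"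
begin

text \<open>Let \<open>U\<close> be a minimal image of a nonconstant unary polynomial of the simple algebra \<open>A\<close>; every
  unary polynomial mapping \<open>U\<close> into itself permutes it or is constant on it. Suppose first that some
  binary polynomial on \<open>U\<close> has a constant row and a nonconstant row. Then \<open>U\<close> carries a polynomial
  operation with a two-sided unit. Among all such operations of \<open>A\<close> and \<open>B\<close>, each with parameters
  from a generating pair, choose one for which the set of binary terms taking the unit as value at
  that pair is maximal. It lifts to the other algebra along the description of \<open>A\<close> as a quotient of
  a subpower of \<open>B\<close>, and maximality singles out a coordinate on which the lift is an isomorphism.

  Otherwise, if \<open>A\<close> is not strongly abelian, some polynomial is a quasigroup operation on \<open>U\<close>, and
  \<open>A\<close> is abelian. Hence retractions onto minimal sets and subtraction on them are given by terms
  that behave uniformly in their parameters. If both algebras have trivial subalgebras, these serve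
  as zero elements and any nonzero elements of minimal sets generate in the same way. Trivial
  subalgebras exist in both algebras or in neither, and if there are none, then there is a unary
  term \<open>\<sigma>\<close> on whose range all differences of unary terms are constant, so that
  \<open>\<sigma>(a) \<mapsto> \<sigma>(b)\<close> extends to an isomorphism.\<close>

section \<open>Terms applied to lists\<close>

text \<open>Positions beyond the end of the list read its last entry. Thus the same term yields an
  operation of every positive arity, and passing to fewer arguments identifies trailing variables.\<close>

definition env :: "'x list \<Rightarrow> nat \<Rightarrow> 'x" where
  "env xs i = (if i < length xs then xs ! i else last xs)"

lemma env_0 [simp]: "env (x # xs) 0 = x"
  by (simp add: env_def)

lemma env_single [simp]: "env [x] i = x"
  by (simp add: env_def)

lemma env_Suc [simp]: "env (x # y # ys) (Suc i) = env (y # ys) i"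
  by (auto simp: env_def)

lemma env_numeral [simp]:
  "env [x, y, z, w] 2 = z" "env [x, y, z, w] 3 = w" "env [x, y, z] 2 = z"
  by (simp_all add: numeral_2_eq_2 numeral_3_eq_3)

lemma env_tail: "ys \<noteq> [] \<Longrightarrow> env (x # ys) (Suc i) = env ys i"
  by (cases ys) auto

lemma env_map: "ts \<noteq> [] \<Longrightarrow> env (map f ts) i = f (env ts i)"
  by (auto simp: env_def last_map)

lemma env_mem: "xs \<noteq> [] \<Longrightarrow> env xs i \<in> set xs"
  by (auto simp: env_def)

lemma map_env_upt: "map (env xs) [0..<length xs] = xs"
  by (rule nth_equalityI) (auto simp: env_def)

fun subst :: "('v \<Rightarrow> ('f, 'w) trm) \<Rightarrow> ('f, 'v) trm \<Rightarrow> ('f, 'w) trm" where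
  "subst s (Var x) = s x"
| "subst s (Op f ts) = Op f (map (subst s) ts)"

lemma eval_subst: "eval F v (subst s t) = eval F (\<lambda>i. eval F v (s i)) t"
  by (induction t) (auto cong: map_cong simp: o_def)

lemma wf_subst: "wf_trm ar t \<Longrightarrow> (\<And>i. wf_trm ar (s i)) \<Longrightarrow> wf_trm ar (subst s t)"
  by (induction t) auto

definition ap :: "('f \<Rightarrow> 'a list \<Rightarrow> 'a) \<Rightarrow> ('f, nat) trm \<Rightarrow> 'a list \<Rightarrow> 'a" where
  "ap F t xs = eval F (env xs) t"

definition sub :: "('f, nat) trm list \<Rightarrow> ('f, nat) trm \<Rightarrow> ('f, nat) trm" where
  "sub ts t = subst (env ts) t"

lemma ap_Var [simp]: "ap F (Var i) xs = env xs i"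
  by (simp add: ap_def)

lemma ap_sub [simp]: "ts \<noteq> [] \<Longrightarrow> ap F (sub ts t) xs = ap F t (map (\<lambda>s. ap F s xs) ts)"
  unfolding ap_def sub_def eval_subst by (simp add: env_map[symmetric] cong: if_cong)

lemma wf_sub [simp]:
  "ts \<noteq> [] \<Longrightarrow> (\<forall>s\<in>set ts. wf_trm ar s) \<Longrightarrow> wf_trm ar t \<Longrightarrow> wf_trm ar (sub ts t)"
  unfolding sub_def using env_mem by (intro wf_subst) blast+

text \<open>\<open>n\<close> counts the iterated variable 0 together with the parameters 1 to
  \<open>n - 1\<close>, which stay fixed.\<close>

fun itr :: "nat \<Rightarrow> ('f, nat) trm \<Rightarrow> nat \<Rightarrow> ('f, nat) trm" where
  "itr n t 0 = Var 0"
| "itr n t (Suc k) = sub (itr n t k # map Var [1..<n]) t"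

lemma wf_itr [simp]: "wf_trm ar t \<Longrightarrow> wf_trm ar (itr n t k)"
  by (induction k) auto

lemma ap_itr: "ap F (itr (Suc (length ys)) t k) (x # ys) = ((\<lambda>x. ap F t (x # ys)) ^^ k) x"
proof (induction k)
  case (Suc k)
  have "map (\<lambda>i. env (x # ys) i) [1..<Suc (length ys)] = ys"
    by (rule nth_equalityI) (auto simp: env_def simp del: upt_Suc)
  with Suc show ?case by (simp add: o_def del: upt_Suc)
qed simp

lemma ap_itr2 [simp]: "ap F (itr 2 t k) [x, y] = ((\<lambda>x. ap F t [x, y]) ^^ k) x"
  using ap_itr[of F "[y]" t k x] by (simp add: numeral_2_eq_2)

lemma ap_itr3 [simp]: "ap F (itr 3 t k) [x, y, z] = ((\<lambda>x. ap F t [x, y, z]) ^^ k) x"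
  using ap_itr[of F "[y, z]" t k x] by (simp add: numeral_3_eq_3)

lemma ap_itr4 [simp]: "ap F (itr 4 t k) [x, y, z, w] = ((\<lambda>x. ap F t [x, y, z, w]) ^^ k) x"
  using ap_itr[of F "[y, z, w]" t k x] by (simp add: eval_nat_numeral)

section \<open>Iterates of self-maps of finite sets\<close>

lemma funpow_closed: "h ` X \<subseteq> X \<Longrightarrow> x \<in> X \<Longrightarrow> (h ^^ k) x \<in> X"
  by (induction k) auto

text \<open>The orbit of \<open>x\<close> enters a cycle of some length \<open>p \<le> K\<close>
  after at most \<open>K\<close> steps, and \<open>p\<close> divides \<open>fact K\<close>. One
  exponent serves all self-maps of sets of size at most \<open>K\<close>, so a term can use it
  uniformly in its parameters.\<close>

lemma funpow_fact_idem:
  assumes "finite X" "h ` X \<subseteq> X" "card X \<le> K" "x \<in> X"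
  shows "(h ^^ fact K) ((h ^^ fact K) x) = (h ^^ fact K) x"
proof -
  have "\<not> inj_on (\<lambda>i. (h ^^ i) x) {0..K}"
  proof
    assume "inj_on (\<lambda>i. (h ^^ i) x) {0..K}"
    then have "card {0..K} \<le> card X"
      using card_inj_on_le[of _ "{0..K}" X] funpow_closed[OF assms(2,4)] assms(1) by blast
    with assms(3) show False by simp
  qed
  then obtain i j where ij: "i < j" "j \<le> K" "(h ^^ i) x = (h ^^ j) x"
    unfolding inj_on_def by (metis atLeastAtMost_iff linorder_neqE_nat)
  define p where "p = j - i"
  have p: "p > 0" "p \<le> K" using ij by (auto simp: p_def)
  have step: "(h ^^ (n + p)) x = (h ^^ n) x" if "i \<le> n" for n
  proof -
    have "n + p = (n - i) + j" using that ij by (simp add: p_def)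
    then have "(h ^^ (n + p)) x = (h ^^ (n - i)) ((h ^^ j) x)" by (simp add: funpow_add)
    also have "\<dots> = (h ^^ (n - i)) ((h ^^ i) x)" using ij by simp
    also have "\<dots> = (h ^^ ((n - i) + i)) x" by (simp only: funpow_add o_apply)
    finally show ?thesis using that by simp
  qed
  have steps: "(h ^^ (n + c * p)) x = (h ^^ n) x" if "i \<le> n" for n c
  proof (induction c)
    case (Suc c)
    have "(h ^^ (n + Suc c * p)) x = (h ^^ ((n + c * p) + p)) x" by (simp add: algebra_simps)
    then show ?case using step[of "n + c * p"] that Suc by simp
  qed simp
  obtain c where c: "fact K = c * p"
    using dvd_fact[of p K] p by (metis dvd_def mult.commute One_nat_def Suc_leI)
  have "i \<le> fact K" using ij fact_ge_self[of K] by linarith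
  then have "(h ^^ (fact K + c * p)) x = (h ^^ fact K) x" by (rule steps)
  then show ?thesis using c by (simp add: funpow_add)
qed

lemma funpow_fact_id:
  assumes "finite X" "h ` X \<subseteq> X" "card X \<le> K" "inj_on h X" "x \<in> X"
  shows "(h ^^ fact K) x = x"
proof -
  have "inj_on (h ^^ k) X" for k
  proof (induction k)
    case (Suc k)
    have "(h ^^ k) ` X \<subseteq> X" using funpow_closed[OF assms(2)] by blast
    with Suc assms(4) show ?case
      by (simp only: funpow.simps) (blast intro: comp_inj_on inj_on_subset)
  qed simp
  then show ?thesis
    using funpow_fact_idem[OF assms(1,2,3,5)] funpow_closed[OF assms(2,5)] assms(5)
    by (meson inj_onD)
qed

text \<open>Inverses of permutations of finite sets are powers, hence expressible by terms.\<close>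

lemma funpow_fact_inverse:
  assumes "finite X" "h ` X \<subseteq> X" "card X \<le> K" "inj_on h X" "x \<in> X"
  shows "h ((h ^^ (fact K - 1)) x) = x" "(h ^^ (fact K - 1)) (h x) = x"
proof -
  have "fact K = Suc (fact K - 1)" by simp
  then have eq: "h ^^ fact K = h ^^ Suc (fact K - 1)" by simp
  note * = funpow_fact_id[OF assms, unfolded eq]
  show "h ((h ^^ (fact K - 1)) x) = x" using * by (simp only: funpow.simps o_apply)
  then show "(h ^^ (fact K - 1)) (h x) = x" by (simp only: funpow_swap1)
qed

section \<open>Polynomial functions\<close>

text \<open>The subalgebra of a power generated by \<open>X\<close>. Generated by projections and
  constants, it consists of polynomial functions; the index type is \<open>'a\<close> for one
  variable, pairs for two, assignments for arbitrarily many.\<close>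

inductive_set clo :: "('f \<Rightarrow> nat) \<Rightarrow> ('f \<Rightarrow> 'a list \<Rightarrow> 'a) \<Rightarrow> ('i \<Rightarrow> 'a) set \<Rightarrow> ('i \<Rightarrow> 'a) set"
  for ar F X where
  base: "\<phi> \<in> X \<Longrightarrow> \<phi> \<in> clo ar F X"
| op: "length \<phi>s = ar f \<Longrightarrow> \<forall>\<phi>\<in>set \<phi>s. \<phi> \<in> clo ar F X \<Longrightarrow>
    (\<lambda>i. F f (map (\<lambda>\<phi>. \<phi> i) \<phi>s)) \<in> clo ar F X"

locale ss_algebra =
  fixes ar :: "'f \<Rightarrow> nat" and A :: "'a set" and F :: "'f \<Rightarrow> 'a list \<Rightarrow> 'a"
  assumes ss: "strictly_simple ar A F"
begin

lemma alg: "length xs = ar f \<Longrightarrow> set xs \<subseteq> A \<Longrightarrow> F f xs \<in> A"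
  using ss by (auto simp: strictly_simple_def is_algebra_def)

lemma fin [simp]: "finite A"
  using ss by (simp add: strictly_simple_def)

lemma two: obtains x y where "x \<in> A" "y \<in> A" "x \<noteq> y"
  using ss by (auto simp: strictly_simple_def simple_alg_def)

lemma eval_closed: "wf_trm ar t \<Longrightarrow> (\<And>i. v i \<in> A) \<Longrightarrow> eval F v t \<in> A"
proof (induction t)
  case (Op f ts)
  then show ?case by (auto intro!: alg)
qed simp

lemma ap_closed: "wf_trm ar t \<Longrightarrow> xs \<noteq> [] \<Longrightarrow> set xs \<subseteq> A \<Longrightarrow> ap F t xs \<in> A"
  unfolding ap_def using env_mem by (intro eval_closed) blast+

definition pol :: "('i \<Rightarrow> 'a) set \<Rightarrow> ('i \<Rightarrow> 'a) set" where
  "pol X = clo ar F (X \<union> {\<lambda>_. c |c. c \<in> A})"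

abbreviation pol1 :: "('a \<Rightarrow> 'a) set" where "pol1 \<equiv> pol {\<lambda>x. x}"
abbreviation pol2 :: "('a \<times> 'a \<Rightarrow> 'a) set" where "pol2 \<equiv> pol {fst, snd}"

lemma pol_gen: "x \<in> X \<Longrightarrow> x \<in> pol X"
  by (simp add: pol_def clo.base)

lemma pol_const: "c \<in> A \<Longrightarrow> (\<lambda>_. c) \<in> pol X"
  unfolding pol_def by (rule clo.base) blast

lemma pol_op:
  "length \<phi>s = ar f \<Longrightarrow> \<forall>\<phi>\<in>set \<phi>s. \<phi> \<in> pol X \<Longrightarrow> (\<lambda>i. F f (map (\<lambda>\<phi>. \<phi> i) \<phi>s)) \<in> pol X"
  unfolding pol_def by (rule clo.op)

lemma pol_comp:
  assumes "\<phi> \<in> pol X" "\<And>x. x \<in> X \<Longrightarrow> (\<lambda>j. x (g j)) \<in> pol Y"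
  shows "(\<lambda>j. \<phi> (g j)) \<in> pol Y"
  using assms(1) unfolding pol_def
proof (induction rule: clo.induct)
  case (base \<phi>)
  then show ?case using assms(2) pol_const unfolding pol_def by auto
next
  case (op \<phi>s f)
  have "(\<lambda>j. F f (map (\<lambda>\<psi>. \<psi> j) (map (\<lambda>\<phi> j. \<phi> (g j)) \<phi>s))) \<in> clo ar F (Y \<union> {\<lambda>_. c |c. c \<in> A})"
    using op by (intro clo.op) auto
  then show ?case by (simp add: o_def)
qed

lemma pol1_comp: "\<phi> \<in> pol1 \<Longrightarrow> g \<in> pol Y \<Longrightarrow> (\<lambda>j. \<phi> (g j)) \<in> pol Y"
  by (rule pol_comp) auto

lemma pol2_comp: "\<phi> \<in> pol2 \<Longrightarrow> g \<in> pol Y \<Longrightarrow> h \<in> pol Y \<Longrightarrow> (\<lambda>j. \<phi> (g j, h j)) \<in> pol Y"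
  by (rule pol_comp[where g = "\<lambda>j. (g j, h j)"]) auto

lemma pol_id: "(\<lambda>x. x) \<in> pol1"
  by (rule pol_gen) simp

lemma pol_fst: "fst \<in> pol2" and pol_snd: "snd \<in> pol2"
  by (auto intro: pol_gen)

lemma pol_closed: "\<phi> \<in> pol X \<Longrightarrow> (\<And>x. x \<in> X \<Longrightarrow> x j \<in> A) \<Longrightarrow> \<phi> j \<in> A"
  unfolding pol_def
proof (induction rule: clo.induct)
  case (op \<phi>s f)
  then show ?case by (intro alg) auto
qed auto

lemma pol1_closed: "\<phi> \<in> pol1 \<Longrightarrow> x \<in> A \<Longrightarrow> \<phi> x \<in> A"
  by (rule pol_closed) auto

lemma pol_eval:
  assumes "wf_trm ar t" "\<And>i. (\<lambda>j. v j i) \<in> pol Y"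
  shows "(\<lambda>j. eval F (v j) t) \<in> pol Y"
  using assms(1)
proof (induction t)
  case (Op f ts)
  have "(\<lambda>j. F f (map (\<lambda>\<phi>. \<phi> j) (map (\<lambda>t j. eval F (v j) t) ts))) \<in> pol Y"
    using Op by (intro pol_op) auto
  then show ?case by (simp add: o_def)
qed (simp add: assms(2))

lemma pol1_funpow: "\<phi> \<in> pol1 \<Longrightarrow> (\<lambda>x. (\<phi> ^^ k) x) \<in> pol1"
proof (induction k)
  case (Suc k)
  then show ?case using pol1_comp[of \<phi> "\<lambda>x. (\<phi> ^^ k) x"] by simp
qed (simp add: pol_id id_def)

lemma pol2_funpow:
  assumes "\<phi> \<in> pol2"
  shows "(\<lambda>z. ((\<lambda>y. \<phi> (fst z, y)) ^^ k) (snd z)) \<in> pol2"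
proof (induction k)
  case (Suc k)
  then show ?case
    using pol2_comp[OF assms pol_fst Suc] by simp
qed (use pol_snd in simp)

lemma pol_term:
  assumes "\<phi> \<in> pol X" "\<And>x. x \<in> X \<Longrightarrow> \<exists>k. \<forall>i. x i = v i k"
    and "\<And>c. c \<in> A \<Longrightarrow> \<exists>s. wf_trm ar s \<and> (\<forall>i. eval F (v i) s = c)"
  shows "\<exists>t. wf_trm ar t \<and> (\<forall>i. \<phi> i = eval F (v i) t)"
  using assms(1) unfolding pol_def
proof (induction rule: clo.induct)
  case (base \<phi>)
  then show ?case
  proof
    assume "\<phi> \<in> X"
    then obtain k where "\<forall>i. \<phi> i = v i k" using assms(2) by blast
    then show ?thesis by (intro exI[of _ "Var k"]) simp
  next
    assume "\<phi> \<in> {\<lambda>_. c |c. c \<in> A}"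
    then show ?thesis using assms(3) by force
  qed
next
  case (op \<phi>s f)
  then obtain t where t: "\<And>\<phi>. \<phi> \<in> set \<phi>s \<Longrightarrow> wf_trm ar (t \<phi>) \<and> (\<forall>i. \<phi> i = eval F (v i) (t \<phi>))"
    by metis
  have "F f (map (\<lambda>\<phi>. \<phi> i) \<phi>s) = eval F (v i) (Op f (map t \<phi>s))" for i
    using t by (auto simp: o_def intro!: arg_cong[where f = "F f"])
  then show ?case using t op(1) by (intro exI[of _ "Op f (map t \<phi>s)"]) auto
qed

section \<open>Generating lists, and polynomials as terms with generators as parameters\<close>

definition gens :: "'a list \<Rightarrow> bool" where
  "gens gs \<longleftrightarrow> gs \<noteq> [] \<and> set gs \<subseteq> A \<and> (\<forall>c\<in>A. \<exists>s. wf_trm ar s \<and> ap F s gs = c)"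

lemma gens_shift:
  assumes "gens gs" "c \<in> A"
  shows "\<exists>s. wf_trm ar s \<and> (\<forall>x. ap F s (x # gs) = c)"
proof -
  obtain s where "wf_trm ar s" "ap F s gs = c" using assms by (auto simp: gens_def)
  moreover have "gs \<noteq> []" using assms by (simp add: gens_def)
  ultimately show ?thesis
    by (intro exI[of _ "subst (\<lambda>i. Var (Suc i)) s"])
      (simp add: wf_subst ap_def eval_subst env_tail)
qed

text \<open>Constants are replaced by terms in the generators. In this form a polynomial can be
  interpreted in the other algebra and at other parameters.\<close>

lemma pol1_term:
  assumes "gens gs" "\<phi> \<in> pol1"
  shows "\<exists>t. wf_trm ar t \<and> (\<forall>x. \<phi> x = ap F t (x # gs))"
  unfolding ap_def
proof (rule pol_term[OF assms(2)])
  show "\<exists>k. \<forall>i. x i = env (i # gs) k" if "x \<in> {\<lambda>x. x}" for x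
    using that by (intro exI[of _ 0]) simp
qed (use gens_shift[OF assms(1)] in \<open>auto simp: ap_def\<close>)

lemma pol2_term:
  assumes "gens gs" "\<phi> \<in> pol2"
  shows "\<exists>t. wf_trm ar t \<and> (\<forall>x y. \<phi> (x, y) = ap F t (x # y # gs))"
proof -
  have "\<exists>t. wf_trm ar t \<and> (\<forall>z. \<phi> z = eval F (env (fst z # snd z # gs)) t)"
  proof (rule pol_term[OF assms(2)])
    show "\<exists>k. \<forall>i. x i = env (fst i # snd i # gs) k" if "x \<in> {fst, snd}" for x
      using that by (auto intro: exI[of _ 0] exI[of _ "Suc 0"])
    show "\<exists>s. wf_trm ar s \<and> (\<forall>i. eval F (env (fst i # snd i # gs)) s = c)" if "c \<in> A" for c
    proof -
      obtain s where "wf_trm ar s" "\<forall>x. ap F s (x # gs) = c" using gens_shift assms(1) \<open>c \<in> A\<close> by blast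
      then show ?thesis
        by (intro exI[of _ "subst (\<lambda>i. Var (Suc i)) s"])
          (simp add: wf_subst eval_subst ap_def)
    qed
  qed
  then show ?thesis by (fastforce simp: ap_def)
qed

text \<open>Arguments are exchanged one at a time. Each exchange is an application of a unary
  polynomial, and transitivity joins the steps.\<close>

lemma congruence_pol1:
  assumes "equiv A \<theta>" "\<And>x y h. (x, y) \<in> \<theta> \<Longrightarrow> h \<in> pol1 \<Longrightarrow> (h x, h y) \<in> \<theta>"
  shows "congruence ar A F \<theta>"
  unfolding congruence_def
proof (intro conjI allI impI, fact, elim conjE)
  fix f xs ys
  assume len: "length xs = ar f" "length ys = ar f" and A: "set xs \<subseteq> A" "set ys \<subseteq> A"
    and xy: "list_all2 (\<lambda>x y. (x, y) \<in> \<theta>) xs ys"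
  have "k \<le> ar f \<Longrightarrow> (F f xs, F f (take k ys @ drop k xs)) \<in> \<theta>" for k
  proof (induction k)
    case 0
    have "F f xs \<in> A" using len A by (intro alg) auto
    then show ?case using assms(1) by (simp add: equiv_def refl_on_def)
  next
    case (Suc k)
    then have k: "k < length xs" "k < length ys" using len by auto
    define \<phi>s :: "('a \<Rightarrow> 'a) list"
      where "\<phi>s = map (\<lambda>c _. c) (take k ys) @ (\<lambda>x. x) # map (\<lambda>c _. c) (drop (Suc k) xs)"
    define h where "h = (\<lambda>x. F f (map (\<lambda>\<phi>. \<phi> x) \<phi>s))"
    have "h \<in> pol1" unfolding h_def
    proof (rule pol_op)
      show "length \<phi>s = ar f" using k len by (simp add: \<phi>s_def)
      have "c \<in> A" if "c \<in> set (take k ys) \<union> set (drop (Suc k) xs)" for c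
        using that A set_take_subset[of k ys] set_drop_subset[of "Suc k" xs] by auto
      then show "\<forall>\<phi>\<in>set \<phi>s. \<phi> \<in> pol1"
        by (auto simp: \<phi>s_def intro: pol_const pol_id)
    qed
    have h: "h z = F f (take k ys @ z # drop (Suc k) xs)" for z
      by (simp add: h_def \<phi>s_def o_def)
    have "(h (xs ! k), h (ys ! k)) \<in> \<theta>"
      using assms(2) \<open>h \<in> pol1\<close> xy k by (auto simp: list_all2_conv_all_nth)
    moreover have "take k ys @ xs ! k # drop (Suc k) xs = take k ys @ drop k xs"
      using k by (simp add: Cons_nth_drop_Suc)
    moreover have "take k ys @ ys ! k # drop (Suc k) xs = take (Suc k) ys @ drop (Suc k) xs"
      using k by (simp add: take_Suc_conv_app_nth)
    ultimately have "(F f (take k ys @ drop k xs), F f (take (Suc k) ys @ drop (Suc k) xs)) \<in> \<theta>"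
      by (simp add: h)
    with Suc show ?case using assms(1) by (meson Suc_leD equivE transD)
  qed
  from this[of "ar f"] show "(F f xs, F f ys) \<in> \<theta>" using len by simp
qed

text \<open>The main use of simplicity. Agreement of \<open>\<chi> (g x)\<close> for all unary
  polynomials \<open>g\<close> is a congruence; \<open>x0\<close>, \<open>y0\<close> show that it is
  not full, so it is equality. In applications \<open>\<chi>\<close> is a map or a
  predicate.\<close>

lemma separate:
  assumes "x \<in> A" "y \<in> A" "x \<noteq> y" and "x0 \<in> A" "y0 \<in> A" "\<chi> x0 \<noteq> \<chi> y0"
  shows "\<exists>g\<in>pol1. \<chi> (g x) \<noteq> \<chi> (g y)"
proof (rule ccontr)
  assume neg: "\<not> ?thesis"
  define \<theta> where "\<theta> = {(x, y). x \<in> A \<and> y \<in> A \<and> (\<forall>g\<in>pol1. \<chi> (g x) = \<chi> (g y))}"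
  have "congruence ar A F \<theta>"
  proof (rule congruence_pol1)
    show "equiv A \<theta>" by (auto simp: \<theta>_def equiv_def refl_on_def sym_def trans_def)
    show "(h x, h y) \<in> \<theta>" if "(x, y) \<in> \<theta>" "h \<in> pol1" for x y h
      using that pol1_comp[OF _ that(2)] by (fastforce simp: \<theta>_def pol1_closed)
  qed
  moreover have "(x, y) \<in> \<theta>" using neg assms by (auto simp: \<theta>_def)
  moreover have "(x0, y0) \<notin> \<theta>" using assms pol_id by (force simp: \<theta>_def)
  ultimately show False
    using ss assms by (auto simp: strictly_simple_def simple_alg_def)
qed

section \<open>Trivial subalgebras and generation\<close>

definition triv :: "'a \<Rightarrow> bool" where
  "triv x \<longleftrightarrow> x \<in> A \<and> (\<forall>f. F f (replicate (ar f) x) = x)"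

lemma triv_eval: "triv x \<Longrightarrow> wf_trm ar t \<Longrightarrow> eval F (\<lambda>_. x) t = x"
proof (induction t)
  case (Op f ts)
  then have "map (eval F (\<lambda>_. x)) ts = replicate (ar f) x"
    by (intro replicate_eqI) auto
  with Op show ?case by (simp add: triv_def)
qed simp

lemma triv_ap:
  assumes "triv x" "wf_trm ar t" "set xs = {x}"
  shows "ap F t xs = x"
proof -
  have "env xs = (\<lambda>_. x)" using env_mem[of xs] assms(3) by force
  then show ?thesis using triv_eval[OF assms(1,2)] by (simp add: ap_def)
qed

text \<open>The values of terms at \<open>gs\<close> form a subalgebra. If it were proper it would
  be a single element, hence a trivial subalgebra equal to \<open>set gs\<close>.\<close>

lemma gensI:
  assumes "gs \<noteq> []" "set gs \<subseteq> A" "\<And>x. triv x \<Longrightarrow> set gs \<noteq> {x}"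
  shows "gens gs"
proof -
  define S where "S = {ap F s gs |s. wf_trm ar s}"
  have SA: "S \<subseteq> A" using assms by (auto simp: S_def intro: ap_closed)
  have sub: "subuniverse ar A F S"
    unfolding subuniverse_def
  proof (intro conjI allI impI, fact, elim conjE)
    fix f xs assume len: "length xs = ar f" and "set xs \<subseteq> S"
    then have "\<forall>x\<in>set xs. \<exists>s. wf_trm ar s \<and> ap F s gs = x" by (auto simp: S_def)
    then obtain t where t: "\<And>x. x \<in> set xs \<Longrightarrow> wf_trm ar (t x) \<and> ap F (t x) gs = x" by metis
    then have "ap F (Op f (map t xs)) gs = F f xs"
      by (auto simp: ap_def o_def intro!: arg_cong[where f = "F f"] map_idI)
    moreover have "wf_trm ar (Op f (map t xs))" using t len by auto
    ultimately show "F f xs \<in> S" unfolding S_def by (metis (mono_tags, lifting) mem_Collect_eq)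
  qed
  have gsS: "set gs \<subseteq> S"
  proof
    fix x assume "x \<in> set gs"
    then obtain i where "i < length gs" "gs ! i = x" by (auto simp: in_set_conv_nth)
    then have "ap F (Var i) gs = x" by (simp add: env_def)
    then show "x \<in> S" unfolding S_def by (metis (mono_tags, lifting) mem_Collect_eq wf_trm.simps(1))
  qed
  have "S = A"
  proof (rule ccontr)
    assume "S \<noteq> A"
    then have "card S \<le> 1" using ss sub by (auto simp: strictly_simple_def)
    moreover obtain x where x: "x \<in> set gs" using assms(1) by (cases gs) auto
    moreover have "finite S" using SA finite_subset fin by blast
    ultimately have S: "S = {x}" using gsS card_le_Suc0_iff_eq[of S] by auto
    have "F f (replicate (ar f) x) \<in> S" for f
      using sub S unfolding subuniverse_def by (metis length_replicate set_replicate_conv_if subset_refl empty_subsetI)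
    then have "triv x" using x assms(2) S by (auto simp: triv_def)
    moreover have "set gs = {x}" using gsS S x by auto
    ultimately show False using assms(3) by blast
  qed
  then show ?thesis using assms by (auto simp: gens_def S_def)
qed

lemma gens_pair: "x \<in> A \<Longrightarrow> y \<in> A \<Longrightarrow> x \<noteq> y \<Longrightarrow> gens [x, y]"
  by (rule gensI) auto

lemma gens_single: "x \<in> A \<Longrightarrow> \<not> triv x \<Longrightarrow> gens [x]"
  by (rule gensI) auto

end

section \<open>Algebras generating the same variety\<close>

locale ss_pair = A: ss_algebra ar A F + B: ss_algebra ar B G
  for ar :: "'f \<Rightarrow> nat" and A :: "'a set" and F and B :: "'b set" and G +
  assumes same: "same_variety ar A F B G"
begin

lemma swap: "ss_pair ar B G A F"
  using same by unfold_locales (auto simp: same_variety_def)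

lemma transfer:
  assumes "wf_trm ar s" "wf_trm ar t" "ys \<noteq> []" "set ys \<subseteq> B"
    and eq: "\<And>xs. length xs = length ys \<Longrightarrow> set xs \<subseteq> A \<Longrightarrow> ap F s xs = ap F t xs"
  shows "ap G s ys = ap G t ys"
proof -
  \<comment> \<open>Substituting \<open>vs\<close> sends every variable beyond the list to the last
    one, so an equation at all lists of this length becomes an identity for all assignments.\<close>
  define vs :: "('f, nat) trm list" where "vs = map Var [0..<length ys]"
  have vs: "vs \<noteq> []" using assms by (simp add: vs_def)
  have sub: "eval H v (sub vs r) = ap H r (map v [0..<length ys])" for H :: "'f \<Rightarrow> 'c list \<Rightarrow> 'c" and v r
  proof -
    have "(\<lambda>i. eval H v (env vs i)) = env (map (eval H v) vs)"
      by (rule ext) (simp add: env_map[OF vs])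
    then show ?thesis by (simp add: sub_def eval_subst ap_def vs_def o_def)
  qed
  have "satisfies_eq ar A F (sub vs s) (sub vs t)"
    unfolding satisfies_eq_def sub by (intro allI impI eq) auto
  moreover have "wf_trm ar (sub vs s)" "wf_trm ar (sub vs t)"
    using vs assms by (auto simp: vs_def)
  ultimately have "satisfies_eq ar B G (sub vs s) (sub vs t)"
    using same unfolding same_variety_def by blast
  moreover have "range (env ys) \<subseteq> B" using assms env_mem by blast
  ultimately show ?thesis
    unfolding satisfies_eq_def sub by (metis map_env_upt)
qed

lemma transfer1:
  assumes "wf_trm ar s" "wf_trm ar t" "\<And>x. x \<in> A \<Longrightarrow> ap F s [x] = ap F t [x]" "x \<in> B"
  shows "ap G s [x] = ap G t [x]"
  using assms by (intro transfer) (auto simp: length_Suc_conv)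

lemma transfer2:
  assumes "wf_trm ar s" "wf_trm ar t" "\<And>x y. x \<in> A \<Longrightarrow> y \<in> A \<Longrightarrow> ap F s [x, y] = ap F t [x, y]"
    "x \<in> B" "y \<in> B"
  shows "ap G s [x, y] = ap G t [x, y]"
  using assms by (intro transfer) (auto simp: length_Suc_conv)

lemma transfer3:
  assumes "wf_trm ar s" "wf_trm ar t"
    "\<And>x y z. x \<in> A \<Longrightarrow> y \<in> A \<Longrightarrow> z \<in> A \<Longrightarrow> ap F s [x, y, z] = ap F t [x, y, z]"
    "x \<in> B" "y \<in> B" "z \<in> B"
  shows "ap G s [x, y, z] = ap G t [x, y, z]"
  using assms by (intro transfer) (auto simp: length_Suc_conv)

text \<open>The assumption makes \<open>ap F s xs \<mapsto> ap G s ys\<close> a well-defined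
  homomorphism, onto because \<open>ys\<close> generates. Its kernel is a congruence of the simple
  algebra \<open>A\<close>, and not the full one since \<open>B\<close> has two elements.\<close>

lemma isomorphic_of_gens:
  assumes xs: "A.gens xs" and ys: "B.gens ys"
    and eq: "\<And>s t. wf_trm ar s \<Longrightarrow> wf_trm ar t \<Longrightarrow> ap F s xs = ap F t xs \<Longrightarrow> ap G s ys = ap G t ys"
  shows "isomorphic_alg ar A F B G"
proof -
  define c where "c x = (SOME s. wf_trm ar s \<and> ap F s xs = x)" for x
  have c: "wf_trm ar (c x)" "ap F (c x) xs = x" if "x \<in> A" for x
    using someI_ex[of "\<lambda>s. wf_trm ar s \<and> ap F s xs = x"] that xs
    by (auto simp: c_def A.gens_def)
  define h where "h x = ap G (c x) ys" for x
  have xsA: "xs \<noteq> []" "set xs \<subseteq> A" and ysB: "ys \<noteq> []" "set ys \<subseteq> B"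
    using xs ys by (auto simp: A.gens_def B.gens_def)
  have h: "h (ap F s xs) = ap G s ys" if "wf_trm ar s" for s
    unfolding h_def using that xsA A.ap_closed by (intro eq) (auto simp: c)
  have hom: "h (F f zs) = G f (map h zs)" if "length zs = ar f" "set zs \<subseteq> A" for f zs
  proof -
    have "ap F (Op f (map c zs)) xs = F f zs"
      using that c(2) by (auto simp: ap_def o_def intro!: arg_cong[where f = "F f"] map_idI)
    moreover have "wf_trm ar (Op f (map c zs))" using that c(1) by auto
    ultimately have "h (F f zs) = ap G (Op f (map c zs)) ys" using h by metis
    also have "\<dots> = G f (map h zs)" by (simp add: ap_def h_def[abs_def] o_def)
    finally show ?thesis .
  qed
  have im: "h ` A = B"
  proof
    show "h ` A \<subseteq> B" using c ysB B.ap_closed by (auto simp: h_def)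
    show "B \<subseteq> h ` A"
    proof
      fix y assume "y \<in> B"
      then obtain s where "wf_trm ar s" "ap G s ys = y" using ys by (auto simp: B.gens_def)
      then show "y \<in> h ` A" using h xsA A.ap_closed by (metis image_eqI)
    qed
  qed
  define \<theta> where "\<theta> = {(x, y). x \<in> A \<and> y \<in> A \<and> h x = h y}"
  have "congruence ar A F \<theta>"
    unfolding congruence_def
  proof (intro conjI allI impI; (elim conjE)?)
    show "equiv A \<theta>" by (auto simp: \<theta>_def equiv_def refl_on_def sym_def trans_def)
    fix f us vs
    assume uv: "length us = ar f" "length vs = ar f" "set us \<subseteq> A" "set vs \<subseteq> A"
      "list_all2 (\<lambda>x y. (x, y) \<in> \<theta>) us vs"
    then have "map h us = map h vs"
      by (auto simp: list_all2_conv_all_nth \<theta>_def intro!: nth_equalityI)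
    with uv show "(F f us, F f vs) \<in> \<theta>" by (simp add: \<theta>_def hom A.alg)
  qed
  moreover have "\<theta> \<noteq> A \<times> A"
  proof
    assume "\<theta> = A \<times> A"
    then have "h x = h y" if "x \<in> A" "y \<in> A" for x y using that by (auto simp: \<theta>_def)
    moreover obtain x y where "x \<in> B" "y \<in> B" "x \<noteq> y" by (rule B.two)
    ultimately show False using im by (metis imageE)
  qed
  ultimately have "\<theta> = Id_on A"
    using A.ss by (auto simp: strictly_simple_def simple_alg_def)
  then have "inj_on h A" by (auto simp: inj_on_def \<theta>_def)
  with im hom show ?thesis
    unfolding isomorphic_alg_def bij_betw_def by blast
qed

end

section \<open>Minimal sets\<close>

text \<open>Only the finitely many coordinates in \<open>S\<close> matter. Passing from
  \<open>u\<close> to \<open>v\<close> one of them at a time, some single change switches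
  \<open>P\<close> from true to false.\<close>

lemma change_one_variable:
  fixes u v :: "nat \<Rightarrow> 'a"
  assumes "finite S" and supp: "\<And>e e'. (\<forall>i\<in>S. e i = e' i) \<Longrightarrow> P e = P e'"
    and "P u" "\<not> P v" "range u \<subseteq> A" "range v \<subseteq> A"
  obtains w j y y' where "range w \<subseteq> A" "y \<in> A" "y' \<in> A" "u j \<noteq> v j"
    "\<And>i. u i = v i \<Longrightarrow> w i = u i" "P (w(j := y))" "\<not> P (w(j := y'))"
proof -
  define mix where "mix D = (\<lambda>i. if i \<in> D then v i else u i)" for D :: "nat set"
  have ex: "\<exists>w j y y'. range w \<subseteq> A \<and> y \<in> A \<and> y' \<in> A \<and> u j \<noteq> v j \<and>
    (\<forall>i. u i = v i \<longrightarrow> w i = u i) \<and> P (w(j := y)) \<and> \<not> P (w(j := y'))"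
    if "finite D" "\<not> P (mix D)" for D
    using that
  proof (induction D rule: finite_induct)
    case empty
    then show ?case using assms by (simp add: mix_def)
  next
    case (insert j D)
    show ?case
    proof (cases "P (mix D)")
      case True
      have *: "(mix D)(j := u j) = mix D" "(mix D)(j := v j) = mix (insert j D)"
        using insert.hyps by (auto simp: mix_def)
      have "u j \<noteq> v j" using True insert.prems * by metis
      moreover have "range (mix D) \<subseteq> A" using assms by (auto simp: mix_def)
      moreover have "u j \<in> A" "v j \<in> A" using assms by auto
      ultimately show ?thesis using True insert.prems *
        by (intro exI[of _ "mix D"] exI[of _ j] exI[of _ "u j"] exI[of _ "v j"]) (auto simp: mix_def)
    qed (use insert in blast)
  qed
  have "\<not> P (mix S)"
    using supp[of "mix S" v] assms by (simp add: mix_def)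
  from ex[OF \<open>finite S\<close> this] show ?thesis
    by (elim exE conjE) (rule that; simp)
qed

context ss_algebra
begin

abbreviation polw :: "((nat \<Rightarrow> 'a) \<Rightarrow> 'a) set" where "polw \<equiv> pol (range (\<lambda>i e. e i))"

lemma polw_comp:
  assumes "T \<in> polw" "\<And>i. (\<lambda>j. v j i) \<in> pol Y"
  shows "(\<lambda>j. T (v j)) \<in> pol Y"
  by (rule pol_comp[OF assms(1)]) (use assms(2) in auto)

lemma pol_fun_upd:
  assumes "\<And>i. (\<lambda>j. v j i) \<in> pol Y" "p \<in> pol Y"
  shows "(\<lambda>j. ((v j)(k := p j)) i) \<in> pol Y"
  using assms by (cases "i = k") auto

lemma polw_closed: "T \<in> polw \<Longrightarrow> range w \<subseteq> A \<Longrightarrow> T w \<in> A"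
  by (erule pol_closed) auto

lemma polw_support:
  assumes "T \<in> polw"
  shows "\<exists>S. finite S \<and> (\<forall>e e'. (\<forall>i\<in>S. e i = e' i) \<longrightarrow> T e = T e')"
  using assms unfolding pol_def
proof (induction rule: clo.induct)
  case (base \<phi>)
  then consider i where "\<phi> = (\<lambda>e. e i)" | c where "\<phi> = (\<lambda>_. c)" by auto
  then show ?case
  proof cases
    case 1
    then show ?thesis by (intro exI[of _ "{i}"]) auto
  next
    case 2
    then show ?thesis by (intro exI[of _ "{}"]) auto
  qed
next
  case (op \<phi>s f)
  then obtain S where S: "\<And>\<phi>. \<phi> \<in> set \<phi>s \<Longrightarrow> finite (S \<phi>) \<and> (\<forall>e e'. (\<forall>i\<in>S \<phi>. e i = e' i) \<longrightarrow> \<phi> e = \<phi> e')"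
    by metis
  have "F f (map (\<lambda>\<phi>. \<phi> e) \<phi>s) = F f (map (\<lambda>\<phi>. \<phi> e') \<phi>s)" if "\<forall>i\<in>\<Union> (S ` set \<phi>s). e i = e' i" for e e'
    using that S by (intro arg_cong[where f = "F f"] map_cong) auto
  then show ?case using S by (intro exI[of _ "\<Union> (S ` set \<phi>s)"]) blast
qed

lemma polw_term: "wf_trm ar t \<Longrightarrow> (\<lambda>e. eval F e t) \<in> polw"
  by (rule pol_eval) (auto intro: pol_gen)

text \<open>Minimal sets in the sense of tame congruence theory, each together with an idempotent
  polynomial retraction \<open>e\<close> onto it.\<close>

definition minset :: "'a set \<Rightarrow> ('a \<Rightarrow> 'a) \<Rightarrow> bool" where
  "minset U e \<longleftrightarrow> e \<in> pol1 \<and> U \<subseteq> A \<and> e ` A \<subseteq> U \<and> (\<forall>x\<in>U. e x = x) \<and> (\<exists>x\<in>U. \<exists>y\<in>U. x \<noteq> y) \<and>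
    (\<forall>\<phi>\<in>pol1. (\<exists>x\<in>A. \<exists>y\<in>A. \<phi> x \<noteq> \<phi> y) \<longrightarrow> card U \<le> card (\<phi> ` A))"

text \<open>Let \<open>f\<close> be nonconstant with smallest image \<open>U\<close>. Separation
  gives \<open>g\<close> with \<open>f g f\<close> nonconstant; by minimality \<open>h = f g\<close>
  permutes \<open>U\<close>, and a power of it is the retraction.\<close>

lemma minset_exists: "\<exists>U e. minset U e"
proof -
  let ?nc = "\<lambda>\<phi>. \<phi> \<in> pol1 \<and> (\<exists>x\<in>A. \<exists>y\<in>A. \<phi> x \<noteq> \<phi> y)"
  have "?nc (\<lambda>x. x)" using two pol_id by metis
  then obtain f where f: "?nc f" and min: "\<And>\<phi>. ?nc \<phi> \<Longrightarrow> card (f ` A) \<le> card (\<phi> ` A)"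
    using ex_has_least_nat[of ?nc "\<lambda>x. x" "\<lambda>\<phi>. card (\<phi> ` A)"] by blast
  define U where "U = f ` A"
  have UA: "U \<subseteq> A" using f pol1_closed by (auto simp: U_def)
  have finU: "finite U" by (simp add: U_def)
  obtain x0 y0 where xy0: "x0 \<in> A" "y0 \<in> A" "f x0 \<noteq> f y0" using f by blast
  then obtain g where g: "g \<in> pol1" "f (g (f x0)) \<noteq> f (g (f y0))"
    using separate[of "f x0" "f y0" x0 y0 f] pol1_closed f by blast
  define h where "h = (\<lambda>x. f (g x))"
  have h1: "h \<in> pol1" unfolding h_def using f g pol1_comp by blast
  have hU: "h ` U \<subseteq> U" using UA g pol1_closed by (auto simp: h_def U_def)
  have "?nc (\<lambda>x. h (f x))" using pol1_comp[OF h1, of f] f xy0 g by (auto simp: h_def)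
  from min[OF this] have "card U \<le> card (h ` U)" by (simp add: U_def image_image)
  then have inj: "inj_on h U"
    using finU hU by (metis card_image_le eq_card_imp_inj_on le_antisym)
  define e where "e = (\<lambda>x. (h ^^ fact (card A)) x)"
  have "e \<in> pol1" unfolding e_def by (rule pol1_funpow[OF h1])
  moreover have "e ` A \<subseteq> U"
  proof -
    have "fact (card A) = Suc (fact (card A) - 1)" by simp
    then have "e x = h ((h ^^ (fact (card A) - 1)) x)" for x
      unfolding e_def by (metis funpow.simps(2) o_apply)
    moreover have "(h ^^ k) x \<in> A" if "x \<in> A" for x k
      using funpow_closed[of h A x k] pol1_closed[OF h1] that by auto
    moreover have "h x \<in> U" if "x \<in> A" for x using g that pol1_closed by (auto simp: h_def U_def)
    ultimately show ?thesis by auto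
  qed
  moreover have "e x = x" if "x \<in> U" for x
    unfolding e_def using funpow_fact_id[OF finU hU _ inj that] card_mono[OF fin UA] by blast
  moreover have "f x0 \<in> U" "f y0 \<in> U" using xy0 by (auto simp: U_def)
  ultimately have "minset U e"
    unfolding minset_def using UA xy0(3) min[folded U_def] by blast
  then show ?thesis by blast
qed

text \<open>The polynomial \<open>\<phi> (e x)\<close> is nonconstant and its image is that of
  \<open>U\<close> under \<open>\<phi>\<close>, which by minimality is no smaller than
  \<open>U\<close>.\<close>

lemma minset_inj:
  assumes U: "minset U e" and "\<phi> \<in> pol1" "x \<in> U" "y \<in> U" "\<phi> x \<noteq> \<phi> y"
  shows "inj_on \<phi> U"
proof -
  have UA: "U \<subseteq> A" and e: "\<And>x. x \<in> U \<Longrightarrow> e x = x" and "e ` A \<subseteq> U"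
    using U by (simp_all add: minset_def)
  then have eU: "e ` A = U" by (metis image_eqI subsetD subsetI subset_antisym)
  have "(\<lambda>x. \<phi> (e x)) \<in> pol1" using U assms pol1_comp by (auto simp: minset_def)
  moreover have "\<phi> (e x) \<noteq> \<phi> (e y)" using assms e by simp
  moreover have "x \<in> A" "y \<in> A" using UA assms by auto
  moreover have "\<forall>\<phi>\<in>pol1. (\<exists>x\<in>A. \<exists>y\<in>A. \<phi> x \<noteq> \<phi> y) \<longrightarrow> card U \<le> card (\<phi> ` A)"
    using U by (simp add: minset_def)
  ultimately have "card U \<le> card ((\<lambda>x. \<phi> (e x)) ` A)" by metis
  also have "(\<lambda>x. \<phi> (e x)) ` A = \<phi> ` U" using eU by (metis image_image)
  finally show ?thesis
    using finite_subset[OF UA fin] by (metis card_image_le eq_card_imp_inj_on le_antisym)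
qed

section \<open>Binary polynomials on a minimal set\<close>

definition mixed :: "'a set \<Rightarrow> bool" where
  "mixed U \<longleftrightarrow> (\<exists>Q\<in>pol2. (\<forall>x\<in>U. \<forall>y\<in>U. Q (x, y) \<in> U) \<and> (\<exists>r0\<in>U. \<exists>r1\<in>U.
    (\<forall>y\<in>U. \<forall>y'\<in>U. Q (r0, y) = Q (r0, y')) \<and> (\<exists>y\<in>U. \<exists>y'\<in>U. Q (r1, y) \<noteq> Q (r1, y'))))"

definition latin :: "'a set \<Rightarrow> bool" where
  "latin U \<longleftrightarrow> (\<exists>Q\<in>pol2. (\<forall>x\<in>U. \<forall>y\<in>U. Q (x, y) \<in> U) \<and>
    (\<forall>x\<in>U. inj_on (\<lambda>y. Q (x, y)) U) \<and> (\<forall>y\<in>U. inj_on (\<lambda>x. Q (x, y)) U))"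

text \<open>Otherwise, separation by the predicate "nonconstant row" gives a polynomial
  \<open>g\<close> taking two elements of \<open>U\<close> to rows of different kinds, and
  \<open>Q (g x, y)\<close> makes \<open>U\<close> mixed. The gain is that rows are indexed by all
  of \<open>A\<close>.\<close>

lemma unmixed_rows:
  assumes U: "minset U e" and "\<not> mixed U" "Q \<in> pol2"
    and QU: "\<And>x y. x \<in> A \<Longrightarrow> y \<in> U \<Longrightarrow> Q (x, y) \<in> U"
    and "x \<in> A" "r \<in> U" "r' \<in> U" "Q (x, r) \<noteq> Q (x, r')" "x' \<in> A"
  shows "\<exists>r\<in>U. \<exists>r'\<in>U. Q (x', r) \<noteq> Q (x', r')"
proof (rule ccontr)
  assume neg: "\<not> ?thesis"
  let ?S = "\<lambda>x. \<exists>r\<in>U. \<exists>r'\<in>U. Q (x, r) \<noteq> Q (x, r')"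
  obtain u u' where u: "u \<in> U" "u' \<in> U" "u \<noteq> u'" and UA: "U \<subseteq> A" using U by (auto simp: minset_def)
  have "?S x" using assms by blast
  then obtain g where g: "g \<in> pol1" "?S (g u) \<noteq> ?S (g u')"
    using separate[of u u' x x' ?S] u UA neg assms by blast
  then obtain s s' where s: "s \<in> U" "s' \<in> U" "\<not> ?S (g s)" "?S (g s')" using u by blast
  have "(\<lambda>z. Q (g (fst z), snd z)) \<in> pol2"
    using pol2_comp[OF assms(3) pol1_comp[OF g(1) pol_fst] pol_snd] .
  moreover have "\<forall>x\<in>U. \<forall>y\<in>U. Q (g x, y) \<in> U" using QU g UA pol1_closed by blast
  ultimately have "mixed U" unfolding mixed_def
    using s by (intro bexI[of _ "\<lambda>z. Q (g (fst z), snd z)"]) auto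
  with assms(2) show False by simp
qed

text \<open>A failure of strong abelianness, mapped into \<open>U\<close>, yields a polynomial
  \<open>T\<close> that depends on variable 0 and on another variable \<open>j\<close>. By
  \<open>unmixed_rows\<close> each dependence persists when the other variable changes, so by
  minimality rows and columns are injective.\<close>

lemma unmixed_latin:
  assumes U: "minset U e" and nm: "\<not> mixed U" and nsa: "\<not> strongly_abelian ar A F"
  shows "latin U"
proof -
  obtain o1 o2 where o: "o1 \<in> U" "o2 \<in> U" "o1 \<noteq> o2" and UA: "U \<subseteq> A" and e1: "e \<in> pol1"
    and eA: "e ` A \<subseteq> U" and eU: "\<And>x. x \<in> U \<Longrightarrow> e x = x"
    using U by (auto simp: minset_def)
  obtain t :: "('f, nat) trm" and a b c and u v :: "nat \<Rightarrow> 'a"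
    where t: "wf_trm ar t" and abc: "a \<in> A" "b \<in> A" "c \<in> A"
    and uv: "range u \<subseteq> A" "range v \<subseteq> A"
    and eq: "eval F (u(0 := a)) t = eval F (v(0 := b)) t"
    and neq: "eval F (u(0 := c)) t \<noteq> eval F (v(0 := c)) t"
  proof -
    assume *: "\<And>(t :: ('f, nat) trm) a b c (u :: nat \<Rightarrow> 'a) v. wf_trm ar t \<Longrightarrow> a \<in> A \<Longrightarrow> b \<in> A \<Longrightarrow> c \<in> A \<Longrightarrow>
      range u \<subseteq> A \<Longrightarrow> range v \<subseteq> A \<Longrightarrow> eval F (u(0 := a)) t = eval F (v(0 := b)) t \<Longrightarrow>
      eval F (u(0 := c)) t \<noteq> eval F (v(0 := c)) t \<Longrightarrow> thesis"
    show thesis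
    proof (rule ccontr)
      assume "\<not> thesis"
      have "strongly_abelian ar A F" unfolding strongly_abelian_def
      proof (intro allI ballI impI, elim conjE, rule ccontr)
        fix t :: "('f, nat) trm" and a b c and u v :: "nat \<Rightarrow> 'a"
        assume "a \<in> A" "b \<in> A" "c \<in> A" "wf_trm ar t" "range u \<subseteq> A" "range v \<subseteq> A"
          "eval F (u(0 := a)) t = eval F (v(0 := b)) t" "eval F (u(0 := c)) t \<noteq> eval F (v(0 := c)) t"
        from *[OF this(4,1,2,3,5,6,7,8)] \<open>\<not> thesis\<close> show False by contradiction
      qed
      with nsa show False ..
    qed
  qed
  have "eval F (u(0 := c)) t \<in> A" "eval F (v(0 := c)) t \<in> A"
    using t abc uv by (auto intro!: eval_closed simp: image_subset_iff)
  then obtain g where g: "g \<in> pol1" "e (g (eval F (u(0 := c)) t)) \<noteq> e (g (eval F (v(0 := c)) t))"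
    using separate[of _ _ o1 o2 e] neq o eU UA by (metis subsetD)
  define T where "T = (\<lambda>w. e (g (eval F w t)))"
  have T: "T \<in> polw" unfolding T_def using pol1_comp[OF e1 pol1_comp[OF g(1) polw_term[OF t]]] .
  have TU: "T w \<in> U" if "range w \<subseteq> A" for w
    using eA pol1_closed[OF g(1)] polw_closed[OF polw_term[OF t] that] by (auto simp: T_def)
  have Teq: "T (u(0 := a)) = T (v(0 := b))" and Tneq: "T (u(0 := c)) \<noteq> T (v(0 := c))"
    using eq g by (auto simp: T_def)
  obtain S where S: "finite S" "\<And>e e'. (\<forall>i\<in>S. e i = e' i) \<Longrightarrow> T e = T e'"
    using polw_support[OF T] by blast
  have T2: "(\<lambda>z. T (w(j := p (snd z), 0 := q (fst z)))) \<in> pol2" if "range w \<subseteq> A" "p \<in> pol1" "q \<in> pol1" for w j p q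
    using that by (intro polw_comp[OF T] pol_fun_upd) (auto intro: pol_const pol1_comp pol_fst pol_snd)
  \<comment> \<open>If \<open>T\<close> did not depend on variable 0, replacing \<open>a\<close> and
    \<open>b\<close> by \<open>c\<close> in \<open>Teq\<close> would contradict
    \<open>Tneq\<close>.\<close>
  have "\<exists>w x x'. range w \<subseteq> A \<and> x \<in> A \<and> x' \<in> A \<and> T (w(0 := x)) \<noteq> T (w(0 := x'))"
    using uv abc Teq Tneq by metis
  then obtain w' x x' where w': "range w' \<subseteq> A" "x \<in> A" "x' \<in> A" "T (w'(0 := x)) \<noteq> T (w'(0 := x'))"
    by blast
  then obtain f where f: "f \<in> pol1" "T (w'(0 := f o1)) \<noteq> T (w'(0 := f o2))"
    using separate[of o1 o2 x x' "\<lambda>x. T (w'(0 := x))"] o UA by blast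
  \<comment> \<open>\<open>N w\<close> says that variable 0 still matters when it runs only through
    the image of \<open>U\<close> under \<open>f\<close>. If it failed somewhere, changing a single
    variable \<open>j \<noteq> 0\<close> would destroy it, against
    \<open>unmixed_rows\<close>.\<close>
  define N where "N w \<longleftrightarrow> (\<exists>r\<in>U. \<exists>r'\<in>U. T (w(0 := f r)) \<noteq> T (w(0 := f r')))" for w
  have N: "N w" if w: "range w \<subseteq> A" for w
  proof (rule ccontr)
    assume "\<not> N w"
    moreover have "N w'" using f o by (auto simp: N_def)
    moreover have "N e = N e'" if "\<forall>i\<in>S. e i = e' i" for e e'
    proof -
      have "T (e(0 := y)) = T (e'(0 := y))" for y using that by (intro S(2)) auto
      then show ?thesis by (simp add: N_def)
    qed
    ultimately obtain w1 j y y' where w1: "range w1 \<subseteq> A" "y \<in> A" "y' \<in> A"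
      "N (w1(j := y))" "\<not> N (w1(j := y'))"
      using change_one_variable[OF S(1), of N w' w A] w w' by metis
    have "j \<noteq> 0"
    proof
      assume "j = 0"
      with w1(4,5) show False by (simp add: N_def)
    qed
    then have sw: "w1(0 := p, j := q) = w1(j := q, 0 := p)" for p q by (simp add: fun_upd_twist)
    let ?Q = "\<lambda>z. T (w1(0 := f (snd z), j := fst z))"
    have Q2: "?Q \<in> pol2"
      using w1 f by (intro polw_comp[OF T] pol_fun_upd) (auto intro: pol_const pol1_comp pol_fst pol_snd)
    have QU: "?Q (x, y) \<in> U" if "x \<in> A" "y \<in> U" for x y
      using that w1 f UA pol1_closed by (intro TU) auto
    obtain r r' where r: "r \<in> U" "r' \<in> U" "?Q (y, r) \<noteq> ?Q (y, r')"
      using w1(4) unfolding N_def by (simp add: sw) blast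
    have "\<exists>r\<in>U. \<exists>r'\<in>U. ?Q (y', r) \<noteq> ?Q (y', r')"
      by (rule unmixed_rows[OF U nm Q2 QU w1(2) r w1(3)])
    then show False using w1(5) unfolding N_def by (simp add: sw)
  qed
  let ?P = "\<lambda>w. T w = T (u(0 := c))"
  have P: "?P e = ?P e'" if "\<forall>i\<in>S. e i = e' i" for e e' using S(2)[OF that] by simp
  have uvc: "range (u(0 := c)) \<subseteq> A" "range (v(0 := c)) \<subseteq> A"
    using uv abc by (simp_all add: image_subset_iff)
  \<comment> \<open>The two assignments agree at 0, so the changed coordinate \<open>j\<close> is
    not 0 and \<open>w\<close> keeps the value \<open>c\<close> there.\<close>
  obtain w j y y' where w: "range w \<subseteq> A" "y \<in> A" "y' \<in> A" "(u(0 := c)) j \<noteq> (v(0 := c)) j"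
    and w0: "\<And>i. (u(0 := c)) i = (v(0 := c)) i \<Longrightarrow> w i = (u(0 := c)) i"
    and wT: "?P (w(j := y))" "\<not> ?P (w(j := y'))"
    by (rule change_one_variable[of S ?P, OF S(1) P refl Tneq[symmetric] uvc]) (assumption, rule that)
  have j: "j \<noteq> 0" "w 0 = c" using w(4) w0[of 0] by (auto split: if_splits)
  have "T (w(j := y)) \<noteq> T (w(j := y'))" using wT by metis
  then obtain k where k: "k \<in> pol1" "T (w(j := k o1)) \<noteq> T (w(j := k o2))"
    using separate[of o1 o2 y y' "\<lambda>y. T (w(j := y))"] o UA w by blast
  have wc: "w(j := y, 0 := c) = w(j := y)" for y using j by auto
  let ?Q = "\<lambda>q z. T (w(j := k (snd z), 0 := q (fst z)))"
  have rows: "\<exists>s\<in>U. \<exists>s'\<in>U. ?Q (\<lambda>x. x) (x, s) \<noteq> ?Q (\<lambda>x. x) (x, s')" if "x \<in> A" for x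
  proof (rule unmixed_rows[OF U nm])
    show "?Q (\<lambda>x. x) \<in> pol2" using T2 w k pol_id by blast
    show "?Q (\<lambda>x. x) (x, y) \<in> U" if "x \<in> A" "y \<in> U" for x y
      using that w k UA pol1_closed by (intro TU) auto
    show "?Q (\<lambda>x. x) (c, o1) \<noteq> ?Q (\<lambda>x. x) (c, o2)" using k wc by simp
  qed (use abc o that in auto)
  show ?thesis unfolding latin_def
  proof (intro bexI conjI ballI)
    show Q: "?Q f \<in> pol2" using T2 w k f by blast
    show "?Q f (x, y) \<in> U" if "x \<in> U" "y \<in> U" for x y
      using that w k f UA pol1_closed by (intro TU) auto
    fix r assume r: "r \<in> U"
    then have rA: "r \<in> A" using UA by blast
    show "inj_on (\<lambda>y. ?Q f (r, y)) U"
    proof -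
      obtain s s' where "s \<in> U" "s' \<in> U" "?Q f (r, s) \<noteq> ?Q f (r, s')"
        using rows[of "f r"] pol1_closed f rA by auto
      then show ?thesis
        using minset_inj[OF U pol2_comp[OF Q pol_const[OF rA] pol_id]] by blast
    qed
    show "inj_on (\<lambda>y. ?Q f (y, r)) U"
    proof -
      have "N (w(j := k r))" using w k rA pol1_closed by (intro N) auto
      then obtain s s' where "s \<in> U" "s' \<in> U" "?Q f (s, r) \<noteq> ?Q f (s', r)" by (auto simp: N_def)
      then show ?thesis
        using minset_inj[OF U pol2_comp[OF Q pol_id pol_const[OF rA]]] by blast
    qed
  qed
qed

text \<open>This is abelianness of \<open>A\<close>, with variable 0 distinguished.\<close>

definition term_condition :: bool where
  "term_condition \<longleftrightarrow> (\<forall>(t :: ('f, nat) trm) u v. \<forall>a\<in>A. \<forall>b\<in>A. wf_trm ar t \<and> range u \<subseteq> A \<and> range v \<subseteq> A \<and>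
    eval F (u(0 := a)) t = eval F (u(0 := b)) t \<longrightarrow> eval F (v(0 := a)) t = eval F (v(0 := b)) t)"

lemma latin_difference:
  assumes UA: "U \<subseteq> A" and "latin U" "o1 \<in> U"
  obtains d where "d \<in> pol2" "\<And>x y. x \<in> U \<Longrightarrow> y \<in> U \<Longrightarrow> d (x, y) \<in> U"
    "\<And>x y. x \<in> U \<Longrightarrow> y \<in> U \<Longrightarrow> d (x, y) = o1 \<longleftrightarrow> x = y"
proof -
  obtain Q where Q: "Q \<in> pol2" and QU: "\<And>x y. x \<in> U \<Longrightarrow> y \<in> U \<Longrightarrow> Q (x, y) \<in> U"
    and inj: "\<And>x. x \<in> U \<Longrightarrow> inj_on (\<lambda>y. Q (x, y)) U" "\<And>y. y \<in> U \<Longrightarrow> inj_on (\<lambda>x. Q (x, y)) U"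
    using assms by (auto simp: latin_def)
  \<comment> \<open>The power inverts the row of \<open>y\<close>, so \<open>l y\<close> solves
    \<open>Q (y, l y) = o1\<close>; then \<open>Q (x, l y)\<close> acts as a difference of
    \<open>x\<close> and \<open>y\<close> with zero \<open>o1\<close>.\<close>
  define l where "l y = ((\<lambda>z. Q (y, z)) ^^ (fact (card A) - 1)) o1" for y
  have l: "l y \<in> U" "Q (y, l y) = o1" if "y \<in> U" for y
  proof -
    have im: "(\<lambda>z. Q (y, z)) ` U \<subseteq> U" using QU that by auto
    show "l y \<in> U" unfolding l_def by (rule funpow_closed[OF im \<open>o1 \<in> U\<close>])
    show "Q (y, l y) = o1" unfolding l_def
      using funpow_fact_inverse(1)[OF finite_subset[OF UA fin] im card_mono[OF fin UA] inj(1)[OF that] \<open>o1 \<in> U\<close>] .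
  qed
  have "o1 \<in> A" using assms by blast
  have lp: "l \<in> pol1"
    unfolding l_def
    using pol2_comp[OF pol2_funpow[OF Q] pol_id pol_const[OF \<open>o1 \<in> A\<close>]] by simp
  show thesis
  proof (rule that)
    show "(\<lambda>z. Q (fst z, l (snd z))) \<in> pol2"
      using pol2_comp[OF Q pol_fst pol1_comp[OF lp pol_snd]] .
    fix x y assume xy: "x \<in> U" "y \<in> U"
    then show "Q (fst (x, y), l (snd (x, y))) \<in> U" using QU l by simp
    show "Q (fst (x, y), l (snd (x, y))) = o1 \<longleftrightarrow> x = y"
      using xy l inj(2)[OF l(1)[OF xy(2)]] by (auto dest: inj_onD)
  qed
qed

text \<open>If the condition failed, the difference \<open>E x w\<close> of the values at
  \<open>x\<close> and \<open>a\<close> would be the constant \<open>o1\<close> for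
  \<open>x = a\<close> but would vary with some single variable of \<open>w\<close> for
  \<open>x = b\<close>, against \<open>unmixed_rows\<close>.\<close>

lemma unmixed_term_condition:
  assumes U: "minset U e" and nm: "\<not> mixed U" and lat: "latin U"
  shows term_condition
  unfolding term_condition_def
proof (intro allI ballI impI, elim conjE)
  fix t :: "('f, nat) trm" and u v :: "nat \<Rightarrow> 'a" and a b
  assume ab: "a \<in> A" "b \<in> A" and t: "wf_trm ar t" and uv: "range u \<subseteq> A" "range v \<subseteq> A"
    and eq: "eval F (u(0 := a)) t = eval F (u(0 := b)) t"
  obtain o1 o2 where o: "o1 \<in> U" "o2 \<in> U" "o1 \<noteq> o2" and UA: "U \<subseteq> A" and e1: "e \<in> pol1"
    and eA: "e ` A \<subseteq> U" and eU: "\<And>x. x \<in> U \<Longrightarrow> e x = x"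
    using U by (auto simp: minset_def)
  obtain d where d: "d \<in> pol2" "\<And>x y. x \<in> U \<Longrightarrow> y \<in> U \<Longrightarrow> d (x, y) \<in> U"
    "\<And>x y. x \<in> U \<Longrightarrow> y \<in> U \<Longrightarrow> d (x, y) = o1 \<longleftrightarrow> x = y"
    using latin_difference[OF UA lat o(1)] by blast
  show "eval F (v(0 := a)) t = eval F (v(0 := b)) t"
  proof (rule ccontr)
    assume neq: "eval F (v(0 := a)) t \<noteq> eval F (v(0 := b)) t"
    have "eval F (v(0 := a)) t \<in> A" "eval F (v(0 := b)) t \<in> A"
      using t ab uv by (auto intro!: eval_closed simp: image_subset_iff)
    then obtain g where g: "g \<in> pol1" "e (g (eval F (v(0 := a)) t)) \<noteq> e (g (eval F (v(0 := b)) t))"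
      using separate[of _ _ o1 o2 e] neq o eU UA by (metis subsetD)
    define T where "T = (\<lambda>w. e (g (eval F w t)))"
    have T: "T \<in> polw" unfolding T_def using pol1_comp[OF e1 pol1_comp[OF g(1) polw_term[OF t]]] .
    have TU: "T w \<in> U" if "range w \<subseteq> A" for w
      using eA pol1_closed[OF g(1)] polw_closed[OF polw_term[OF t] that] by (auto simp: T_def)
    define E where "E x w = d (T (w(0 := x)), T (w(0 := a)))" for x w
    have EU: "E x w \<in> U" if "x \<in> A" "range w \<subseteq> A" for x w
      unfolding E_def using that ab by (intro d TU) auto
    have Ea: "E a w = o1" if "range w \<subseteq> A" for w
    proof -
      have "T (w(0 := a)) \<in> U" using that ab by (intro TU) auto
      then show ?thesis using d(3) by (simp add: E_def)
    qed
    have Tab: "T (w(0 := a)) \<in> U" "T (w(0 := b)) \<in> U" if "range w \<subseteq> A" for w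
      using that ab by (auto intro!: TU)
    have "E b u = o1" using eq d(3) Tab[OF uv(1)] by (simp add: E_def T_def)
    moreover have "E b v \<noteq> o1" using g d(3) Tab[OF uv(2)] by (simp add: E_def T_def)
    moreover obtain S where S: "finite S" "\<And>e e'. (\<forall>i\<in>S. e i = e' i) \<Longrightarrow> T e = T e'"
      using polw_support[OF T] by blast
    moreover have "E b e = E b e'" if "\<forall>i\<in>S. e i = e' i" for e e'
    proof -
      have "T (e(0 := y)) = T (e'(0 := y))" for y using that by (intro S(2)) auto
      then show ?thesis by (simp add: E_def)
    qed
    ultimately obtain w j y y' where w: "range w \<subseteq> A" "y \<in> A" "y' \<in> A"
      "E b (w(j := y)) = o1" "E b (w(j := y')) \<noteq> o1"
      using change_one_variable[OF S(1), of "\<lambda>w. E b w = o1" u v A] uv by metis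
    obtain k where k: "k \<in> pol1" "E b (w(j := k o1)) \<noteq> E b (w(j := k o2))"
      using separate[of o1 o2 y y' "\<lambda>y. E b (w(j := y))"] o UA w by (metis subsetD)
    let ?Q = "\<lambda>z. E (fst z) (w(j := k (snd z)))"
    have "?Q \<in> pol2" unfolding E_def
      using w k ab by (intro pol2_comp[OF d(1)] polw_comp[OF T] pol_fun_upd)
        (auto intro: pol_const pol1_comp pol_fst pol_snd)
    then have "\<exists>r\<in>U. \<exists>r'\<in>U. ?Q (a, r) \<noteq> ?Q (a, r')"
    proof (rule unmixed_rows[OF U nm])
      show "?Q (x, y) \<in> U" if "x \<in> A" "y \<in> U" for x y
        using that w k UA pol1_closed by simp (intro EU; auto)
      show "?Q (b, o1) \<noteq> ?Q (b, o2)" using k by simp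
    qed (use ab o in auto)
    moreover have "?Q (a, r) = o1" if "r \<in> U" for r
      using that w k UA pol1_closed by simp (intro Ea; auto)
    ultimately show False by metis
  qed
qed

end

section \<open>The nonabelian case\<close>

text \<open>Idempotence of left translations is included so that iterating \<open>P\<close> in its
  second argument, as the lifting to the other algebra does, leaves it unchanged.\<close>

definition unital :: "'a set \<Rightarrow> ('a \<Rightarrow> 'a \<Rightarrow> 'a) \<Rightarrow> 'a \<Rightarrow> bool" where
  "unital M P u \<longleftrightarrow> u \<in> M \<and> (\<forall>x\<in>M. P x u = x \<and> P u x = x) \<and>
    (\<forall>x\<in>M. \<forall>y\<in>M. P x y \<in> M \<and> P x (P x y) = P x y)"

text \<open>Let \<open>R x\<close> be the idempotent power of \<open>P x\<close>; then
  \<open>R u\<close> is the identity. As \<open>\<sigma> x = R x u\<close> permutes \<open>M\<close>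
  and fixes \<open>u\<close>, undoing \<open>\<sigma>\<close> in the first argument makes
  \<open>u\<close> a right unit and keeps it a left unit.\<close>

lemma unital_of_inj:
  fixes P :: "'a \<Rightarrow> 'a \<Rightarrow> 'a"
  assumes fin: "finite M" and K: "card M \<le> K" and P: "\<And>x y. x \<in> M \<Longrightarrow> y \<in> M \<Longrightarrow> P x y \<in> M"
    and u: "u \<in> M" "inj_on (P u) M"
    and "inj_on (\<lambda>x. (P x ^^ fact K) u) M"
  shows "unital M (\<lambda>x y. (P (((\<lambda>x. (P x ^^ fact K) u) ^^ (fact K - 1)) x) ^^ fact K) y) u"
proof -
  define R where "R x y = (P x ^^ fact K) y" for x y
  define \<sigma> where "\<sigma> x = R x u" for x
  have R: "R x y \<in> M" "R x (R x y) = R x y" if "x \<in> M" "y \<in> M" for x y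
    using funpow_closed[of "P x" M y] funpow_fact_idem[of M "P x" K y] that P fin K by (auto simp: R_def)
  have Ru: "R u y = y" if "y \<in> M" for y
    using funpow_fact_id[of M "P u" K y] that P fin K u by (auto simp: R_def)
  have \<sigma>: "\<sigma> ` M \<subseteq> M" "inj_on \<sigma> M" using R u assms(6) by (auto simp: \<sigma>_def[abs_def] R_def)
  define \<tau> where "\<tau> = (\<sigma> ^^ (fact K - 1))"
  have \<tau>: "\<tau> x \<in> M" "\<sigma> (\<tau> x) = x" "\<tau> (\<sigma> x) = x" if "x \<in> M" for x
    using funpow_closed[OF \<sigma>(1) that] funpow_fact_inverse[OF fin \<sigma>(1) K \<sigma>(2) that] by (simp_all add: \<tau>_def)
  have "\<tau> u = u" using \<tau>(3)[OF u(1)] Ru[OF u(1)] by (simp add: \<sigma>_def)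
  then have "unital M (\<lambda>x y. R (\<tau> x) y) u"
    using \<tau>(1,2) R Ru u(1) by (auto simp: unital_def \<sigma>_def)
  then show ?thesis by (simp add: R_def[abs_def] \<tau>_def \<sigma>_def[abs_def])
qed

lemma funpow_idem: "f (f y) = f y \<Longrightarrow> n > 0 \<Longrightarrow> (f ^^ n) y = f y"
proof (induction n)
  case (Suc n)
  then show ?case by (cases n) auto
qed simp

lemma funpow_fixed: "f y = y \<Longrightarrow> (f ^^ n) y = y"
  by (induction n) auto

context ss_algebra
begin

text \<open>A polynomial operation with unit on a retract, encoded by terms in a generating pair so
  that both algebras can interpret it.\<close>

definition config ::
  "'a \<Rightarrow> 'a \<Rightarrow> ('f, nat) trm \<Rightarrow> ('f, nat) trm \<Rightarrow> ('f, nat) trm \<Rightarrow> bool" where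
  "config c d e p u \<longleftrightarrow> gens [c, d] \<and> wf_trm ar e \<and> wf_trm ar p \<and> wf_trm ar u \<and>
    (\<forall>x\<in>A. ap F e [ap F e [x, c, d], c, d] = ap F e [x, c, d]) \<and>
    (\<exists>x\<in>A. ap F e [x, c, d] \<noteq> ap F u [c, d]) \<and>
    unital ((\<lambda>x. ap F e [x, c, d]) ` A) (\<lambda>x y. ap F p [x, y, c, d]) (ap F u [c, d])"

text \<open>As sets of terms, these can be compared between \<open>A\<close> and \<open>B\<close>;
  they are the measure to be maximized.\<close>

definition unit_terms :: "'a \<Rightarrow> 'a \<Rightarrow> ('f, nat) trm \<Rightarrow> ('f, nat) trm \<Rightarrow> ('f, nat) trm set" where
  "unit_terms c d e u = {w. wf_trm ar w \<and> ap F e [ap F w [c, d], c, d] = ap F u [c, d]}"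

text \<open>Such a set is determined by the pair and the set of elements retracted to the
  unit.\<close>

lemma finite_unit_terms: "finite {unit_terms c d e u |c d e p u. config c d e p u}"
proof (rule finite_subset)
  let ?T = "\<lambda>(c, d, S). {w. wf_trm ar w \<and> ap F w [c, d] \<in> S}"
  show "{unit_terms c d e u |c d e p u. config c d e p u} \<subseteq> ?T ` (A \<times> A \<times> Pow A)"
  proof safe
    fix c d e p u assume "config c d e p u"
    then have cd: "c \<in> A" "d \<in> A" by (auto simp: config_def gens_def)
    then have "unit_terms c d e u = ?T (c, d, {x \<in> A. ap F e [x, c, d] = ap F u [c, d]})"
      by (auto simp: unit_terms_def ap_closed)
    then show "unit_terms c d e u \<in> ?T ` (A \<times> A \<times> Pow A)" using cd by blast
  qed
qed simp

text \<open>The mixed polynomial is normalized until one element \<open>u\<close> acts as the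
  identity and another element \<open>z\<close> as the constant \<open>z\<close>. Then
  \<open>\<sigma>\<close> of \<open>unital_of_inj\<close> fixes both and is injective by minimality.
  The pair \<open>u, z\<close> provides the parameters.\<close>

lemma mixed_config:
  assumes U: "minset U e" and mix: "mixed U"
  shows "\<exists>c d e p u. config c d e p u"
proof -
  have UA: "U \<subseteq> A" and e1: "e \<in> pol1" and eU: "e ` A = U" and e: "\<And>x. x \<in> U \<Longrightarrow> e x = x"
    using U unfolding minset_def by (simp_all, metis image_eqI subsetD subsetI subset_antisym)
  have finU: "finite U" using UA finite_subset fin by blast
  obtain K where K: "card U \<le> K" by blast
  note inverse = funpow_fact_inverse[OF finU _ K]
  obtain Q r0 r1 where Q: "Q \<in> pol2" and QU: "\<And>x y. x \<in> U \<Longrightarrow> y \<in> U \<Longrightarrow> Q (x, y) \<in> U"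
    and r: "r0 \<in> U" "r1 \<in> U" and c0: "\<And>y y'. y \<in> U \<Longrightarrow> y' \<in> U \<Longrightarrow> Q (r0, y) = Q (r0, y')"
    and c1: "\<exists>y\<in>U. \<exists>y'\<in>U. Q (r1, y) \<noteq> Q (r1, y')"
    using mix unfolding mixed_def by blast
  have rA: "r0 \<in> A" "r1 \<in> A" using r UA by auto
  define \<pi> where "\<pi> y = Q (r1, y)" for y
  have \<pi>1: "\<pi> \<in> pol1" unfolding \<pi>_def using pol2_comp[OF Q pol_const[OF rA(2)] pol_id] .
  have \<pi>: "\<pi> ` U \<subseteq> U" "inj_on \<pi> U"
    using QU r c1 minset_inj[OF U \<pi>1] by (auto simp: \<pi>_def)
  \<comment> \<open>Undoing the permutation \<open>\<pi>\<close> makes row \<open>r1\<close> the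
    identity; row \<open>r0\<close> stays constant.\<close>
  define Q1 where "Q1 z = (\<pi> ^^ (fact K - 1)) (Q z)" for z
  have Q1: "Q1 \<in> pol2" unfolding Q1_def using pol1_comp[OF pol1_funpow[OF \<pi>1] Q] .
  have Q1U: "Q1 (x, y) \<in> U" if "x \<in> U" "y \<in> U" for x y
    using funpow_closed[OF \<pi>(1)] QU that by (simp add: Q1_def)
  have Q1r: "Q1 (r1, y) = y" if "y \<in> U" for y
    using inverse(2)[OF \<pi> that] by (simp add: Q1_def \<pi>_def)
  define z where "z = Q1 (r0, r0)"
  have zU: "z \<in> U" using Q1U r by (simp add: z_def)
  have Q1z: "Q1 (r0, y) = z" if "y \<in> U" for y
    using c0[OF that r(1)] by (simp add: Q1_def z_def)
  obtain u where u: "u \<in> U" "u \<noteq> z" using U unfolding minset_def by metis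
  have uA: "u \<in> A" using u UA by blast
  \<comment> \<open>\<open>\<rho>\<close> takes \<open>r0\<close> to \<open>z\<close> and
    \<open>r1\<close> to \<open>u\<close>; its inverse relabels the rows, so that in
    \<open>P\<close> row \<open>u\<close> is the identity and row \<open>z\<close> is
    constant.\<close>
  define \<rho> where "\<rho> x = Q1 (x, u)" for x
  have \<rho>1: "\<rho> \<in> pol1" unfolding \<rho>_def using pol2_comp[OF Q1 pol_id pol_const[OF uA]] .
  have \<rho>r: "\<rho> r0 = z" "\<rho> r1 = u" using Q1z Q1r u by (simp_all add: \<rho>_def)
  have \<rho>: "\<rho> ` U \<subseteq> U" "inj_on \<rho> U"
    using Q1U u minset_inj[OF U \<rho>1 r] \<rho>r by (auto simp: \<rho>_def)
  define P where "P x y = Q1 ((\<rho> ^^ (fact K - 1)) x, y)" for x y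
  have P2: "(\<lambda>z. P (fst z) (snd z)) \<in> pol2" unfolding P_def
    using pol2_comp[OF Q1 pol1_comp[OF pol1_funpow[OF \<rho>1] pol_fst] pol_snd] .
  have PU: "P x y \<in> U" if "x \<in> U" "y \<in> U" for x y
    using Q1U funpow_closed[OF \<rho>(1)] that by (simp add: P_def)
  have "(\<rho> ^^ (fact K - 1)) u = r1" "(\<rho> ^^ (fact K - 1)) z = r0"
    using inverse(2)[OF \<rho> r(1)] inverse(2)[OF \<rho> r(2)] \<rho>r by simp_all
  then have Pu: "P u y = y" and Pz: "P z y = z" if "y \<in> U" for y
    using Q1r Q1z that by (simp_all add: P_def)
  define R where "R x y = (P x ^^ fact K) y" for x y
  have R2: "(\<lambda>z. R (fst z) (snd z)) \<in> pol2" unfolding R_def using pol2_funpow[OF P2] by simp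
  define \<sigma> where "\<sigma> x = R x u" for x
  have \<sigma>1: "\<sigma> \<in> pol1" unfolding \<sigma>_def using pol2_comp[OF R2 pol_id pol_const[OF uA]] by simp
  have "\<sigma> u = u" using funpow_fixed[of "P u" u] Pu u by (simp add: \<sigma>_def R_def)
  moreover have "\<sigma> z = z"
    using funpow_idem[of "P z" u "fact K"] Pz[OF u(1)] Pz[OF zU] by (simp add: \<sigma>_def R_def)
  ultimately have inj1: "inj_on \<sigma> U" using minset_inj[OF U \<sigma>1 u(1) zU] u(2) by simp
  have inj2: "inj_on (P u) U" using Pu by (simp add: inj_on_def)
  have un: "unital U (\<lambda>x y. R ((\<sigma> ^^ (fact K - 1)) x) y) u"
    using unital_of_inj[of U K P u, OF finU K PU u(1) inj2] inj1
    by (simp add: \<sigma>_def[abs_def] R_def[abs_def])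
  have S2: "(\<lambda>z. R ((\<sigma> ^^ (fact K - 1)) (fst z)) (snd z)) \<in> pol2"
    using pol2_comp[OF R2 pol1_comp[OF pol1_funpow[OF \<sigma>1] pol_fst] pol_snd] by simp
  have g: "gens [u, z]" using gens_pair uA zU UA u(2) by blast
  obtain et where et: "wf_trm ar et" "\<And>x. e x = ap F et [x, u, z]"
    using pol1_term[OF g e1] by metis
  obtain pt where pt: "wf_trm ar pt" "\<And>x y. R ((\<sigma> ^^ (fact K - 1)) x) y = ap F pt [x, y, u, z]"
    using pol2_term[OF g S2] by (metis fst_conv snd_conv)
  have "config u z et pt (Var 0)"
    unfolding config_def
  proof (intro conjI ballI bexI)
    show "unital ((\<lambda>x. ap F et [x, u, z]) ` A) (\<lambda>x y. ap F pt [x, y, u, z]) (ap F (Var 0) [u, z])"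
      using un eU by (simp add: et(2)[symmetric] pt(2)[symmetric])
    show "ap F et [ap F et [x, u, z], u, z] = ap F et [x, u, z]" if "x \<in> A" for x
      using that e eU by (auto simp: et(2)[symmetric])
    show "ap F et [z, u, z] \<noteq> ap F (Var 0) [u, z]"
      using e[OF zU] u(2) by (simp add: et(2)[symmetric])
  qed (use g et(1) pt(1) zU UA in auto)
  then show ?thesis by blast
qed

end

context ss_pair
begin

text \<open>Among the terms inducing the given retraction of \<open>A\<close>, take one whose images in \<open>B\<close>,
  over all parameters, have minimal total size. Then every term that is the identity on the
  minimal set of \<open>A\<close> permutes all these images, so that the laws of \<open>p\<close> can be repaired in \<open>B\<close>
  by iteration without changing \<open>p\<close> on \<open>A\<close>.\<close>

lemma config_lift:
  assumes cfg: "A.config c0 d0 e0 p0 u0"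
  obtains e p u where "wf_trm ar e" "wf_trm ar p" "wf_trm ar u"
    "\<And>x. x \<in> A \<Longrightarrow> ap F e [x, c0, d0] = ap F e0 [x, c0, d0]"
    "ap F u [c0, d0] = ap F u0 [c0, d0]"
    "\<And>x y. x \<in> (\<lambda>x. ap F e0 [x, c0, d0]) ` A \<Longrightarrow> y \<in> (\<lambda>x. ap F e0 [x, c0, d0]) ` A \<Longrightarrow>
      ap F p [x, y, c0, d0] = ap F p0 [x, y, c0, d0]"
    "\<And>c d x. c \<in> B \<Longrightarrow> d \<in> B \<Longrightarrow> x \<in> B \<Longrightarrow> ap G e [ap G e [x, c, d], c, d] = ap G e [x, c, d]"
    "\<And>c d. c \<in> B \<Longrightarrow> d \<in> B \<Longrightarrow>
      unital ((\<lambda>x. ap G e [x, c, d]) ` B) (\<lambda>x y. ap G p [x, y, c, d]) (ap G u [c, d])"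
    "\<And>g c d. wf_trm ar g \<Longrightarrow> \<forall>x\<in>(\<lambda>x. ap F e0 [x, c0, d0]) ` A. ap F g [x, c0, d0] = x \<Longrightarrow>
      c \<in> B \<Longrightarrow> d \<in> B \<Longrightarrow> inj_on (\<lambda>x. ap G e [ap G g [x, c, d], c, d]) ((\<lambda>x. ap G e [x, c, d]) ` B)"
proof -
  define E0 where "E0 x = ap F e0 [x, c0, d0]" for x
  define M0 where "M0 = E0 ` A"
  have cd0: "c0 \<in> A" "d0 \<in> A" and wf0: "wf_trm ar e0" "wf_trm ar p0" "wf_trm ar u0"
    and idem0: "\<And>x. x \<in> A \<Longrightarrow> E0 (E0 x) = E0 x"
    and un0: "unital M0 (\<lambda>x y. ap F p0 [x, y, c0, d0]) (ap F u0 [c0, d0])"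
    using cfg by (auto simp: A.config_def A.gens_def E0_def M0_def)
  have E0A: "E0 x \<in> A" if "x \<in> A" for x using that cd0 wf0 by (auto simp: E0_def intro: A.ap_closed)
  have M0: "E0 x = x" "x \<in> A" if "x \<in> M0" for x using that idem0 E0A by (auto simp: M0_def)
  define N :: nat where "N = fact (card B)"
  have N: "N > 0" by (simp add: N_def)
  define cand where "cand e \<longleftrightarrow> wf_trm ar e \<and> (\<forall>x\<in>A. ap F e [x, c0, d0] = E0 x)" for e
  define im where "im e z = (\<lambda>x. ap G e [x, fst z, snd z]) ` B" for e z
  define \<mu> where "\<mu> e = (\<Sum>z\<in>B \<times> B. card (im e z))" for e
  have "cand e0" using wf0 by (simp add: cand_def E0_def)
  then obtain e1 where e1: "cand e1" and min1: "\<And>e. cand e \<Longrightarrow> \<mu> e1 \<le> \<mu> e"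
    using ex_has_least_nat[of cand e0 \<mu>] by blast
  have clos: "ap G t [x, c, d] \<in> B" if "wf_trm ar t" "x \<in> B" "c \<in> B" "d \<in> B" for t x c d
    using that by (auto intro: B.ap_closed)
  \<comment> \<open>Iteration makes the retraction idempotent in \<open>B\<close> for all
    parameters. On \<open>A\<close> nothing changes, and images in \<open>B\<close> do not grow, so
    \<open>e\<close> is still minimal.\<close>
  define e where "e = itr 3 e1 N"
  have wfe: "wf_trm ar e" using e1 by (simp add: e_def cand_def)
  have cand: "cand e"
    unfolding cand_def
  proof (intro conjI ballI wfe)
    fix x assume x: "x \<in> A"
    have "ap F e1 [ap F e1 [x, c0, d0], c0, d0] = ap F e1 [x, c0, d0]"
      using e1 x E0A idem0 by (simp add: cand_def)
    then show "ap F e [x, c0, d0] = E0 x"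
      using funpow_idem[of "\<lambda>x. ap F e1 [x, c0, d0]" x N] N e1 x by (simp add: e_def cand_def)
  qed
  have "im e z \<subseteq> im e1 z" if "z \<in> B \<times> B" for z
  proof -
    have "((\<lambda>x. ap G e1 [x, fst z, snd z]) ^^ N) x \<in> im e1 z" if x: "x \<in> B" for x
    proof -
      obtain k where k: "N = Suc k" using N gr0_conv_Suc by blast
      have "((\<lambda>x. ap G e1 [x, fst z, snd z]) ^^ k) x \<in> B"
        using x \<open>z \<in> B \<times> B\<close> e1 clos by (intro funpow_closed) (auto simp: cand_def)
      then show ?thesis unfolding k im_def by auto
    qed
    then show ?thesis by (auto simp: im_def e_def)
  qed
  then have "card (im e z) \<le> card (im e1 z)" if "z \<in> B \<times> B" for z
    using that by (intro card_mono) (auto simp: im_def)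
  then have "\<mu> e \<le> \<mu> e1" unfolding \<mu>_def by (intro sum_mono)
  then have min: "\<mu> e \<le> \<mu> e'" if "cand e'" for e' using min1[OF that] by simp
  have idem: "ap G e [ap G e [x, c, d], c, d] = ap G e [x, c, d]" if "c \<in> B" "d \<in> B" "x \<in> B" for c d x
    using that e1 clos unfolding e_def N_def
    by (simp add: cand_def) (intro funpow_fact_idem[of B]; auto)
  have inj: "inj_on (\<lambda>x. ap G e [ap G g [x, c, d], c, d]) ((\<lambda>x. ap G e [x, c, d]) ` B)"
    if g: "wf_trm ar g" "\<forall>x\<in>M0. ap F g [x, c0, d0] = x" and cd: "c \<in> B" "d \<in> B" for g c d
  proof -
    \<comment> \<open>The term \<open>e g e\<close> is again a candidate, so minimality of the sum
      forbids any image to shrink; hence \<open>e g\<close> is injective on each image of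
      \<open>e\<close>.\<close>
    define h where "h = sub [sub [e, Var 1, Var 2] g, Var 1, Var 2] e"
    have h: "ap H h [x, y, z] = ap H e [ap H g [ap H e [x, y, z], y, z], y, z]" for H x y z
      by (simp add: h_def)
    have "cand h"
      using cand g wfe idem0 E0A by (auto simp: cand_def h M0_def) (simp add: h_def)
    moreover have imh: "im h z = (\<lambda>x. ap G e [ap G g [x, fst z, snd z], fst z, snd z]) ` im e z" for z
      by (simp add: im_def h image_image)
    have le: "card (im h z) \<le> card (im e z)" if "z \<in> B \<times> B" for z
      unfolding imh by (intro card_image_le) (simp add: im_def)
    ultimately have "\<mu> h = \<mu> e"
      using min[of h] sum_mono[of "B \<times> B" "\<lambda>z. card (im h z)" "\<lambda>z. card (im e z)"]
      by (simp add: \<mu>_def)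
    then have "card (im h (c, d)) = card (im e (c, d))"
      using sum_mono_inv[of "\<lambda>z. card (im h z)" "B \<times> B" "\<lambda>z. card (im e z)" "(c, d)"] le cd
      by (simp add: \<mu>_def)
    then show ?thesis
      unfolding imh by (intro eq_card_imp_inj_on) (simp_all add: im_def)
  qed
  define u where "u = sub [u0, Var 0, Var 1] e"
  have u: "ap H u [c, d] = ap H e [ap H u0 [c, d], c, d]" for H :: "'f \<Rightarrow> 'c list \<Rightarrow> 'c" and c d
    by (simp add: u_def)
  define pa where "pa = sub [p0, Var 2, Var 3] e"
  have pa: "ap H pa [x, y, c, d] = ap H e [ap H p0 [x, y, c, d], c, d]"
    for H :: "'f \<Rightarrow> 'c list \<Rightarrow> 'c" and x y c d by (simp add: pa_def)
  \<comment> \<open>\<open>itr\<close> iterates variable 0, so the first two variables are swapped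
    before and after, to iterate in the second one.\<close>
  define pb where "pb = sub [Var 1, Var 0, Var 2, Var 3] (itr 4 (sub [Var 1, Var 0, Var 2, Var 3] pa) N)"
  have pb: "ap H pb [x, y, c, d] = ((\<lambda>y. ap H pa [x, y, c, d]) ^^ N) y"
    for H :: "'f \<Rightarrow> 'c list \<Rightarrow> 'c" and x y c d by (simp add: pb_def)
  \<comment> \<open>\<open>s x = pb x u\<close> is the identity on \<open>M0\<close> but in
    \<open>B\<close> only a permutation; its inverse power, put into the first argument of
    \<open>pb\<close>, makes \<open>u\<close> a right unit in \<open>B\<close>.\<close>
  define s where "s = sub [Var 0, sub [Var 1, Var 2] u, Var 1, Var 2] pb"
  have s: "ap H s [x, c, d] = ap H pb [x, ap H u [c, d], c, d]"
    for H :: "'f \<Rightarrow> 'c list \<Rightarrow> 'c" and x c d by (simp add: s_def)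
  define p where "p = sub [sub [Var 0, Var 2, Var 3] (itr 3 s (N - 1)), Var 1, Var 2, Var 3] pb"
  have p: "ap H p [x, y, c, d] = ap H pb [((\<lambda>x. ap H s [x, c, d]) ^^ (N - 1)) x, y, c, d]"
    for H :: "'f \<Rightarrow> 'c list \<Rightarrow> 'c" and x y c d by (simp add: p_def)
  have wfu: "wf_trm ar u" and wfpa: "wf_trm ar pa" using wfe wf0 by (simp_all add: u_def pa_def)
  have wfpb: "wf_trm ar pb" using wfpa by (simp add: pb_def)
  have wfs: "wf_trm ar s" using wfu wfpb by (simp add: s_def)
  have wfp: "wf_trm ar p" using wfs wfpb by (simp add: p_def)
  have u0M: "ap F u0 [c0, d0] \<in> M0" using un0 by (simp add: unital_def)
  have uF: "ap F u [c0, d0] = ap F u0 [c0, d0]"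
    using cand M0[OF u0M] by (simp add: u cand_def)
  have paF: "ap F pa [x, y, c0, d0] = ap F p0 [x, y, c0, d0]" if "x \<in> M0" "y \<in> M0" for x y
  proof -
    have "ap F p0 [x, y, c0, d0] \<in> M0" using un0 that by (simp add: unital_def)
    then show ?thesis using cand M0 by (simp add: pa cand_def)
  qed
  have pbF: "ap F pb [x, y, c0, d0] = ap F p0 [x, y, c0, d0]" if xy: "x \<in> M0" "y \<in> M0" for x y
  proof -
    have "ap F p0 [x, y, c0, d0] \<in> M0" "ap F p0 [x, ap F p0 [x, y, c0, d0], c0, d0] = ap F p0 [x, y, c0, d0]"
      using un0 xy by (simp_all add: unital_def)
    then show ?thesis unfolding pb using xy N paF by (subst funpow_idem) simp_all
  qed
  have sF: "ap F s [x, c0, d0] = x" if "x \<in> M0" for x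
    using that pbF[OF that u0M] un0 by (simp add: s uF unital_def)
  have pF: "ap F p [x, y, c0, d0] = ap F p0 [x, y, c0, d0]" if "x \<in> M0" "y \<in> M0" for x y
    using that pbF sF[OF that(1)] by (simp add: p funpow_fixed)
  have un: "unital ((\<lambda>x. ap G e [x, c, d]) ` B) (\<lambda>x y. ap G p [x, y, c, d]) (ap G u [c, d])"
    if cd: "c \<in> B" "d \<in> B" for c d
  proof -
    define M where "M = (\<lambda>x. ap G e [x, c, d]) ` B"
    have MB: "M \<subseteq> B" using clos wfe cd by (auto simp: M_def)
    have eM: "ap G e [x, c, d] = x" if "x \<in> M" for x using that idem cd by (auto simp: M_def)
    have K: "finite M" "card M \<le> card B" using MB B.fin finite_subset card_mono by blast+
    have paM: "ap G pa [x, y, c, d] \<in> M" if "x \<in> M" "y \<in> M" for x y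
      unfolding pa M_def using that MB cd wf0 by (intro imageI B.ap_closed) auto
    have "ap G u0 [c, d] \<in> B" using cd wf0 by (intro B.ap_closed) auto
    then have uM: "ap G u [c, d] \<in> M" by (simp add: u M_def)
    have pbM: "ap G pb [x, y, c, d] \<in> M" if "x \<in> M" "y \<in> M" for x y
      unfolding pb using that paM by (intro funpow_closed) auto
    have sM: "ap G s [x, c, d] \<in> M" if "x \<in> M" for x using that pbM uM by (simp add: s)
    have "inj_on (\<lambda>x. ap G e [ap G s [x, c, d], c, d]) M"
      unfolding M_def using wfs sF cd by (intro inj) auto
    then have "inj_on (\<lambda>x. ap G s [x, c, d]) M"
      using eM sM by (simp add: inj_on_def)
    moreover have "inj_on (\<lambda>x. ap G pa [ap G u [c, d], x, c, d]) M"
    proof -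
      let ?g = "sub [sub [Var 1, Var 2] u, Var 0, Var 1, Var 2] p0"
      have "inj_on (\<lambda>x. ap G e [ap G ?g [x, c, d], c, d]) M"
        unfolding M_def using wf0 wfu cd un0 uF by (intro inj) (auto simp: unital_def)
      then show ?thesis by (simp add: pa)
    qed
    ultimately have "unital M (\<lambda>x y. ((\<lambda>y. ap G pa [((\<lambda>x. ((\<lambda>y. ap G pa [x, y, c, d]) ^^ fact (card B)) (ap G u [c, d]))
        ^^ (fact (card B) - 1)) x, y, c, d]) ^^ fact (card B)) y) (ap G u [c, d])"
      using unital_of_inj[OF K, of "\<lambda>x y. ap G pa [x, y, c, d]" "ap G u [c, d]"] paM uM
      by (simp add: s pb N_def)
    then show ?thesis by (simp add: p pb s N_def M_def)
  qed
  show thesis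
    using that[OF wfe wfp wfu _ uF _ idem un] cand pF inj
    by (simp add: cand_def E0_def M0_def)
qed

text \<open>After lifting, the set of unit terms over \<open>(c0, d0)\<close> is the intersection of the sets of unit
  terms over all pairs \<open>(c, d)\<close> of elements of \<open>B\<close>. By maximality it equals one of them, and since
  unit terms separate points, \<open>(c0, d0) \<mapsto> (c, d)\<close> extends to a homomorphism.\<close>

lemma isomorphic_of_maximal_config:
  assumes cfg: "A.config c0 d0 e0 p0 u0"
    and max: "\<And>c d e p u. B.config c d e p u \<Longrightarrow> A.unit_terms c0 d0 e0 u0 \<subseteq> B.unit_terms c d e u \<Longrightarrow>
      A.unit_terms c0 d0 e0 u0 = B.unit_terms c d e u"
  shows "isomorphic_alg ar A F B G"
proof -
  have cd0: "c0 \<in> A" "d0 \<in> A" and wf0: "wf_trm ar e0" "wf_trm ar p0" "wf_trm ar u0"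
    and g0: "A.gens [c0, d0]"
    using cfg by (auto simp: A.config_def A.gens_def)
  define M0 where "M0 = (\<lambda>x. ap F e0 [x, c0, d0]) ` A"
  have un0: "unital M0 (\<lambda>x y. ap F p0 [x, y, c0, d0]) (ap F u0 [c0, d0])"
    using cfg by (simp add: A.config_def M0_def)
  obtain e p u where wf: "wf_trm ar e" "wf_trm ar p" "wf_trm ar u"
    and eF: "\<And>x. x \<in> A \<Longrightarrow> ap F e [x, c0, d0] = ap F e0 [x, c0, d0]"
    and uF: "ap F u [c0, d0] = ap F u0 [c0, d0]"
    and pF: "\<And>x y. x \<in> M0 \<Longrightarrow> y \<in> M0 \<Longrightarrow> ap F p [x, y, c0, d0] = ap F p0 [x, y, c0, d0]"
    and idem: "\<And>c d x. c \<in> B \<Longrightarrow> d \<in> B \<Longrightarrow> x \<in> B \<Longrightarrow> ap G e [ap G e [x, c, d], c, d] = ap G e [x, c, d]"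
    and un: "\<And>c d. c \<in> B \<Longrightarrow> d \<in> B \<Longrightarrow>
      unital ((\<lambda>x. ap G e [x, c, d]) ` B) (\<lambda>x y. ap G p [x, y, c, d]) (ap G u [c, d])"
    and inj: "\<And>g c d. wf_trm ar g \<Longrightarrow> \<forall>x\<in>M0. ap F g [x, c0, d0] = x \<Longrightarrow> c \<in> B \<Longrightarrow> d \<in> B \<Longrightarrow>
      inj_on (\<lambda>x. ap G e [ap G g [x, c, d], c, d]) ((\<lambda>x. ap G e [x, c, d]) ` B)"
    unfolding M0_def using config_lift[OF cfg] by blast
  have clos: "ap F w [c0, d0] \<in> A" if "wf_trm ar w" for w
    using that cd0 by (intro A.ap_closed) auto
  have closB: "ap G w [c, d] \<in> B" if "wf_trm ar w" "c \<in> B" "d \<in> B" for w c d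
    using that by (intro B.ap_closed) auto
  define T where "T = A.unit_terms c0 d0 e0 u0"
  have T: "w \<in> T \<longleftrightarrow> wf_trm ar w \<and> ap F e [ap F w [c0, d0], c0, d0] = ap F u [c0, d0]" for w
    using eF clos uF by (auto simp: T_def A.unit_terms_def)
  have sub: "T \<subseteq> B.unit_terms c d e u" if cd: "c \<in> B" "d \<in> B" for c d
  proof
    fix w assume "w \<in> T"
    then have w: "wf_trm ar w" "ap F e [ap F w [c0, d0], c0, d0] = ap F u0 [c0, d0]" using T uF by auto
    define M where "M = (\<lambda>x. ap G e [x, c, d]) ` B"
    have MB: "M \<subseteq> B" using cd wf by (auto simp: M_def intro: B.ap_closed)
    have eM: "ap G e [x, c, d] = x" if "x \<in> M" for x using that idem cd by (auto simp: M_def)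
    define x where "x = ap G e [ap G w [c, d], c, d]"
    have x: "x \<in> M" using closB w cd by (simp add: x_def M_def)
    \<comment> \<open>Over \<open>(c0, d0)\<close> the term \<open>w\<close> retracts to the unit,
      so the left translation \<open>g\<close> by it is the identity on \<open>M0\<close>; hence
      over \<open>(c, d)\<close> it is injective on \<open>M\<close>. There it sends both the unit
      and, by idempotence, \<open>x\<close> to \<open>x\<close>, so they coincide.\<close>
    define g where "g = sub [sub [sub [Var 1, Var 2] w, Var 1, Var 2] e, Var 0, Var 1, Var 2] p"
    have gF: "ap F g [y, c0, d0] = y" if "y \<in> M0" for y
    proof -
      have "ap F g [y, c0, d0] = ap F p [ap F u0 [c0, d0], y, c0, d0]" by (simp add: g_def w)
      also have "\<dots> = y" using pF that un0 by (simp add: unital_def)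
      finally show ?thesis .
    qed
    have gG: "ap G g [y, c, d] = ap G p [x, y, c, d]" for y by (simp add: g_def x_def)
    have uni: "unital M (\<lambda>x y. ap G p [x, y, c, d]) (ap G u [c, d])" using un cd by (simp add: M_def)
    have "inj_on (\<lambda>y. ap G e [ap G g [y, c, d], c, d]) M"
      unfolding M_def using gF wf w cd by (intro inj) (auto simp: g_def)
    moreover have "ap G e [ap G p [x, y, c, d], c, d] = ap G p [x, y, c, d]" if "y \<in> M" for y
      using uni x that eM by (simp add: unital_def)
    ultimately have "inj_on (\<lambda>y. ap G p [x, y, c, d]) M"
      by (simp add: inj_on_def gG)
    moreover have uM: "ap G u [c, d] \<in> M" using uni by (simp add: unital_def)
    moreover have xu: "ap G p [x, ap G u [c, d], c, d] = x"
      using uni x by (simp add: unital_def)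
    moreover have "ap G p [x, ap G p [x, ap G u [c, d], c, d], c, d] = ap G p [x, ap G u [c, d], c, d]"
      using uni x uM unfolding unital_def by blast
    then have "ap G p [x, x, c, d] = x" by (simp only: xu)
    ultimately have "x = ap G u [c, d]"
      using x by (metis inj_onD)
    then show "w \<in> B.unit_terms c d e u" using w by (simp add: B.unit_terms_def x_def)
  qed
  obtain x where x: "x \<in> A" "ap F e0 [x, c0, d0] \<noteq> ap F u0 [c0, d0]"
    using cfg by (auto simp: A.config_def)
  obtain w where w: "wf_trm ar w" "ap F w [c0, d0] = x" using g0 x by (auto simp: A.gens_def)
  \<comment> \<open>Otherwise the identity \<open>e(w) = u\<close> would hold in \<open>B\<close>
    and hence in \<open>A\<close>, where \<open>w\<close> was chosen to violate it at
    \<open>(c0, d0)\<close>.\<close>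
  have "\<exists>c\<in>B. \<exists>d\<in>B. ap G e [ap G w [c, d], c, d] \<noteq> ap G u [c, d]"
  proof (rule ccontr)
    assume neg: "\<not> ?thesis"
    have "ap F (sub [w, Var 0, Var 1] e) [c0, d0] = ap F u [c0, d0]"
      by (rule ss_pair.transfer2[OF swap]) (use neg wf w cd0 in auto)
    then show False using w x eF uF by simp
  qed
  then obtain c d where cd: "c \<in> B" "d \<in> B" and ne: "ap G e [ap G w [c, d], c, d] \<noteq> ap G u [c, d]"
    by blast
  have gB: "B.gens [c, d]"
  proof (rule B.gensI)
    fix z assume z: "B.triv z"
    show "set [c, d] \<noteq> {z}"
    proof
      assume "set [c, d] = {z}"
      then have "c = z" "d = z" by auto
      with ne show False using B.triv_ap[OF z] wf w by simp
    qed
  qed (use cd in auto)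
  have wB: "ap G w [c, d] \<in> B" using closB w cd by blast
  have "B.config c d e p u"
    unfolding B.config_def using gB wf idem cd ne wB un by blast
  then have TB: "T = B.unit_terms c d e u"
    using max sub[OF cd] unfolding T_def by blast
  show ?thesis
  proof (rule isomorphic_of_gens[OF g0 gB])
    fix s t assume st: "wf_trm ar s" "wf_trm ar t" and eq: "ap F s [c0, d0] = ap F t [c0, d0]"
    show "ap G s [c, d] = ap G t [c, d]"
    proof (rule ccontr)
      assume neq: "ap G s [c, d] \<noteq> ap G t [c, d]"
      \<comment> \<open>The property of being retracted to the unit. A polynomial separating the
        values of \<open>s\<close> and \<open>t\<close> by it would give two terms with equal values
        in \<open>A\<close> of which only one lies in \<open>T\<close>.\<close>
      let ?\<chi> = "\<lambda>x. ap G e [x, c, d] = ap G u [c, d]"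
      have "ap G u [c, d] \<in> (\<lambda>x. ap G e [x, c, d]) ` B" using un[OF cd] by (simp add: unital_def)
      then have "?\<chi> (ap G u [c, d])" using idem cd by auto
      then obtain g where g: "g \<in> B.pol1" "?\<chi> (g (ap G s [c, d])) \<noteq> ?\<chi> (g (ap G t [c, d]))"
        using B.separate[of "ap G s [c, d]" "ap G t [c, d]" "ap G w [c, d]" "ap G u [c, d]" ?\<chi>]
          neq ne closB[OF _ cd] st wf w by blast
      obtain k where k: "wf_trm ar k" "\<And>x. g x = ap G k [x, c, d]"
        using B.pol1_term[OF gB g(1)] by blast
      have "sub [r, Var 0, Var 1] k \<in> T \<longleftrightarrow> ?\<chi> (g (ap G r [c, d]))" if "wf_trm ar r" for r
        using that k by (simp add: TB B.unit_terms_def)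
      moreover have "sub [s, Var 0, Var 1] k \<in> T \<longleftrightarrow> sub [t, Var 0, Var 1] k \<in> T"
        using st k eq by (simp add: T)
      ultimately show False using g st by blast
    qed
  qed
qed

end

section \<open>The abelian case\<close>

context ss_algebra
begin

lemma term_conditionD:
  assumes tc: term_condition and t: "wf_trm ar t" and x: "x \<in> A" "x' \<in> A"
    and ys: "ys \<noteq> []" "set ys \<subseteq> A" and zs: "zs \<noteq> []" "set zs \<subseteq> A"
    and eq: "ap F t (x # ys) = ap F t (x' # ys)"
  shows "ap F t (x # zs) = ap F t (x' # zs)"
proof -
  have env: "(env (c # us))(0 := y) = env (y # us)" if "us \<noteq> []" for c y us
  proof
    fix i show "((env (c # us))(0 := y)) i = env (y # us) i"
      using that by (cases i) (simp_all add: env_tail)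
  qed
  have ran: "range (env (c # us)) \<subseteq> A" if "c \<in> A" "us \<noteq> []" "set us \<subseteq> A" for c us
  proof (rule image_subsetI)
    fix i show "env (c # us) i \<in> A" using env_mem[of "c # us" i] that by auto
  qed
  from eq have "eval F ((env (x # ys))(0 := x)) t = eval F ((env (x # ys))(0 := x')) t"
    by (simp only: env[OF ys(1)] ap_def)
  then have "eval F ((env (x # zs))(0 := x)) t = eval F ((env (x # zs))(0 := x')) t"
    using tc t x ran[OF x(1) ys] ran[OF x(1) zs] unfolding term_condition_def by blast
  then show ?thesis by (simp only: env[OF zs(1)] ap_def)
qed

lemma pol1_ap:
  assumes "wf_trm ar t" "ys \<noteq> []" "set ys \<subseteq> A"
  shows "(\<lambda>x. ap F t (x # ys)) \<in> pol1"
  unfolding ap_def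
proof (rule pol_eval[OF assms(1)])
  fix i show "(\<lambda>x. env (x # ys) i) \<in> pol1"
  proof (cases i)
    case (Suc k)
    have "env ys k \<in> A" using env_mem[OF assms(2)] assms(3) by blast
    then show ?thesis using Suc assms(2) pol_const by (simp add: env_tail)
  qed (simp add: pol_id)
qed

text \<open>The parameters \<open>a, b\<close> of the retraction and of the quasigroup operation are
  identified to a single variable \<open>y\<close>. By the term condition, the kernel of a term
  function in one argument is the same for all parameters, so cancellation survives for every
  \<open>y\<close>.\<close>

lemma difference_terms:
  assumes U: "minset U \<epsilon>" and lat: "latin U" and tc: term_condition
  obtains e m n where "wf_trm ar e" "wf_trm ar m" "wf_trm ar n"
    "\<And>x y z. x \<in> A \<Longrightarrow> y \<in> A \<Longrightarrow> z \<in> A \<Longrightarrow> ap F e [ap F e [x, y], z] = ap F e [x, z]"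
    "\<And>u v y. u \<in> A \<Longrightarrow> v \<in> A \<Longrightarrow> y \<in> A \<Longrightarrow> ap F e [u, y] = ap F e [v, y] \<Longrightarrow>
      ap F m [u, v, y] = ap F e [y, y]"
    "\<And>u v y. u \<in> A \<Longrightarrow> v \<in> A \<Longrightarrow> y \<in> A \<Longrightarrow> ap F n [ap F m [u, v, y], v, y] = ap F e [u, y]"
    "\<And>u v y. u \<in> A \<Longrightarrow> v \<in> A \<Longrightarrow> y \<in> A \<Longrightarrow> ap F e [ap F m [u, v, y], y] = ap F m [u, v, y]"
    "\<And>y. y \<in> A \<Longrightarrow> \<exists>x\<in>A. \<exists>x'\<in>A. ap F e [x, y] \<noteq> ap F e [x', y]"
    "\<And>\<phi> x x' y. \<phi> \<in> pol1 \<Longrightarrow> x \<in> A \<Longrightarrow> x' \<in> A \<Longrightarrow> y \<in> A \<Longrightarrow>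
      \<phi> (ap F e [x, y]) \<noteq> \<phi> (ap F e [x', y]) \<Longrightarrow> inj_on \<phi> ((\<lambda>x. ap F e [x, y]) ` A)"
proof -
  have UA: "U \<subseteq> A" and \<epsilon>1: "\<epsilon> \<in> pol1" and \<epsilon>A: "\<And>x. x \<in> A \<Longrightarrow> \<epsilon> x \<in> U" and \<epsilon>: "\<And>x. x \<in> U \<Longrightarrow> \<epsilon> x = x"
    and minU: "\<forall>\<phi>\<in>pol1. (\<exists>x\<in>A. \<exists>y\<in>A. \<phi> x \<noteq> \<phi> y) \<longrightarrow> card U \<le> card (\<phi> ` A)"
    using U unfolding minset_def by auto
  obtain a b where ab: "a \<in> U" "b \<in> U" "a \<noteq> b" using U unfolding minset_def by blast
  then have abA: "a \<in> A" "b \<in> A" using UA by auto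
  have g: "gens [a, b]" using gens_pair abA ab by blast
  obtain Q where Q: "Q \<in> pol2" and QU: "\<And>x y. x \<in> U \<Longrightarrow> y \<in> U \<Longrightarrow> Q (x, y) \<in> U"
    and inj: "\<And>x. x \<in> U \<Longrightarrow> inj_on (\<lambda>y. Q (x, y)) U" "\<And>y. y \<in> U \<Longrightarrow> inj_on (\<lambda>x. Q (x, y)) U"
    using lat by (auto simp: latin_def)
  obtain e0 where e0: "wf_trm ar e0" "\<And>x. \<epsilon> x = ap F e0 [x, a, b]"
    using pol1_term[OF g \<epsilon>1] by metis
  obtain q0 where q0: "wf_trm ar q0" "\<And>x y. Q (x, y) = ap F q0 [x, y, a, b]"
    using pol2_term[OF g Q] by metis
  define N :: nat where "N = fact (card A)"
  \<comment> \<open>Iterating keeps \<open>\<epsilon>\<close> at the parameters \<open>a, b\<close>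
    and gives an idempotent map at all others.\<close>
  define W where "W = itr 3 e0 N"
  have wfW: "wf_trm ar W" using e0 by (simp add: W_def)
  have W: "ap F W [x, a, b] = \<epsilon> x" if "x \<in> A" for x
    using funpow_idem[of \<epsilon> x N] \<epsilon>[OF \<epsilon>A[OF that]] by (simp add: W_def e0(2)[symmetric] N_def)
  define e where "e = sub [Var 0, Var 1, Var 1] W"
  have e: "ap F e [x, y] = ap F W [x, y, y]" for x y by (simp add: e_def)
  have wfe: "wf_trm ar e" using wfW by (simp add: e_def)
  have eA: "ap F e [x, y] \<in> A" if "x \<in> A" "y \<in> A" for x y using that wfe by (intro ap_closed) auto
  have ker: "ap F e [x, y] = ap F e [x', y] \<longleftrightarrow> \<epsilon> x = \<epsilon> x'" if "x \<in> A" "x' \<in> A" "y \<in> A" for x x' y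
    using term_conditionD[OF tc wfW that(1,2), of "[y, y]" "[a, b]"]
      term_conditionD[OF tc wfW that(1,2), of "[a, b]" "[y, y]"] that abA by (auto simp: e W)
  have idem: "ap F e [ap F e [x, y], y] = ap F e [x, y]" if "x \<in> A" "y \<in> A" for x y
    unfolding e W_def N_def using that e0(1)
    by simp (intro funpow_fact_idem[of A]; auto intro: ap_closed)
  have par: "ap F e [ap F e [x, y], z] = ap F e [x, z]" if "x \<in> A" "y \<in> A" "z \<in> A" for x y z
    using ker[of "ap F e [x, y]" x y] ker[of "ap F e [x, y]" x z] idem eA that by simp
  have nonconst: "\<exists>x\<in>A. \<exists>x'\<in>A. ap F e [x, y] \<noteq> ap F e [x', y]" if "y \<in> A" for y
    using ker[OF abA that] \<epsilon> ab abA by auto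
  have min: "inj_on \<phi> ((\<lambda>x. ap F e [x, y]) ` A)"
    if \<phi>: "\<phi> \<in> pol1" and x: "x \<in> A" "x' \<in> A" and y: "y \<in> A"
      and ne: "\<phi> (ap F e [x, y]) \<noteq> \<phi> (ap F e [x', y])" for \<phi> x x' y
  proof -
    define M where "M = (\<lambda>x. ap F e [x, y]) ` A"
    have "inj_on \<epsilon> M"
      using ker[OF _ _ y] eA[OF _ y] idem[OF _ y] by (auto simp: inj_on_def M_def)
    moreover have "\<epsilon> ` M \<subseteq> U" using \<epsilon>A eA y by (auto simp: M_def)
    moreover have "finite U" using UA fin finite_subset by blast
    ultimately have "card M \<le> card U" by (rule card_inj_on_le)
    also have "(\<lambda>x. \<phi> (ap F e [x, y])) \<in> pol1"
      using pol1_comp[OF \<phi> pol1_ap[OF wfe, of "[y]"]] y by simp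
    then have "card U \<le> card ((\<lambda>x. \<phi> (ap F e [x, y])) ` A)"
      using bspec[OF minU] x ne by blast
    also have "(\<lambda>x. \<phi> (ap F e [x, y])) ` A = \<phi> ` M" by (simp add: M_def image_image)
    finally have "card M \<le> card (\<phi> ` M)" .
    moreover have "finite M" by (simp add: M_def)
    ultimately have "inj_on \<phi> M" by (metis card_image_le eq_card_imp_inj_on le_antisym)
    then show ?thesis by (simp add: M_def)
  qed
  \<comment> \<open>\<open>Q\<close> with arguments and value retracted by \<open>W\<close>; its
    cancellation over \<open>a, b\<close> passes by the term condition to the parameters
    \<open>y, y\<close> in \<open>q\<close>.\<close>
  define qt where "qt = sub [sub [sub [Var 0, Var 2, Var 3] W, sub [Var 1, Var 2, Var 3] W, Var 2, Var 3] q0,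
    Var 2, Var 3] W"
  have wfqt: "wf_trm ar qt" using wfW q0 by (simp add: qt_def)
  have qt: "ap F qt [x, z, y, y'] = ap F W [ap F q0 [ap F W [x, y, y'], ap F W [z, y, y'], y, y'], y, y']"
    for x z y y' by (simp add: qt_def)
  have qtab: "ap F qt [x, z, a, b] = Q (\<epsilon> x, \<epsilon> z)" if "x \<in> A" "z \<in> A" for x z
  proof -
    have "Q (\<epsilon> x, \<epsilon> z) \<in> U" using QU \<epsilon>A that by simp
    then show ?thesis using that W UA \<epsilon> by (auto simp: qt q0(2)[symmetric])
  qed
  define q where "q = sub [Var 0, Var 1, Var 2, Var 2] qt"
  have wfq: "wf_trm ar q" using wfqt by (simp add: q_def)
  have q: "ap F q [x, z, y] = ap F e [ap F q0 [ap F e [x, y], ap F e [z, y], y, y], y]" for x z y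
    by (simp add: q_def qt e)
  have q1: "ap F e [x, y] = ap F e [x', y]" if eq: "ap F q [x, z, y] = ap F q [x', z, y]"
    and A: "x \<in> A" "x' \<in> A" "z \<in> A" "y \<in> A" for x x' z y
  proof -
    have "ap F qt [x, z, a, b] = ap F qt [x', z, a, b]"
      using term_conditionD[OF tc wfqt A(1,2), of "[z, y, y]" "[z, a, b]"] eq A abA by (simp add: q_def)
    then have "\<epsilon> x = \<epsilon> x'"
      using inj(2)[OF \<epsilon>A[OF A(3)]] \<epsilon>A A by (auto simp: qtab dest: inj_onD)
    then show ?thesis using ker A by simp
  qed
  have q2: "ap F e [z, y] = ap F e [z', y]" if eq: "ap F q [x, z, y] = ap F q [x, z', y]"
    and A: "x \<in> A" "z \<in> A" "z' \<in> A" "y \<in> A" for x z z' y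
  proof -
    let ?t = "sub [Var 1, Var 0, Var 2, Var 3] qt"
    have "ap F ?t [z, x, a, b] = ap F ?t [z', x, a, b]"
      using term_conditionD[OF tc _ A(2,3), of ?t "[x, y, y]" "[x, a, b]"] wfqt eq A abA
      by (simp add: q_def)
    then have "\<epsilon> z = \<epsilon> z'"
      using inj(1)[OF \<epsilon>A[OF A(1)]] \<epsilon>A A by (auto simp: qtab dest: inj_onD)
    then show ?thesis using ker A by simp
  qed
  have q0A: "ap F q0 [ap F e [x, y], ap F e [z, y], y, y] \<in> A" if "x \<in> A" "z \<in> A" "y \<in> A" for x z y
    using that eA q0 by (intro ap_closed) auto
  have qe: "ap F q [ap F e [x, y], z, y] = ap F q [x, z, y]" if "x \<in> A" "y \<in> A" for x z y
    using that idem by (simp add: q)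
  \<comment> \<open>\<open>l(v; y)\<close> solves \<open>q(v, l; y) = e(y; y)\<close> by an inverse
    power started at \<open>e(y; y)\<close>, so that \<open>m(v, v; y)\<close> is zero.\<close>
  define l where "l = sub [sub [Var 1, Var 1] e, Var 0, Var 1] (itr 3 (sub [Var 1, Var 0, Var 2] q) (N - 1))"
  have wfl: "wf_trm ar l" using wfq wfe by (simp add: l_def)
  have l: "ap F l [v, y] = ((\<lambda>z. ap F q [v, z, y]) ^^ (N - 1)) (ap F e [y, y])" for v y
    by (simp add: l_def)
  have lA: "ap F l [v, y] \<in> A" if "v \<in> A" "y \<in> A" for v y using that wfl by (intro ap_closed) auto
  define m where "m = sub [Var 0, sub [Var 1, Var 2] l, Var 2] q"
  have wfm: "wf_trm ar m" using wfq wfl by (simp add: m_def)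
  have m: "ap F m [u, v, y] = ap F q [u, ap F l [v, y], y]" for u v y by (simp add: m_def)
  define n where "n = sub [Var 0, sub [Var 1, Var 2] l, Var 2] (itr 3 q (N - 1))"
  have wfn: "wf_trm ar n" using wfq wfl by (simp add: n_def)
  have n: "ap F n [w, v, y] = ((\<lambda>x. ap F q [x, ap F l [v, y], y]) ^^ (N - 1)) w" for w v y
    by (simp add: n_def)
  have mm: "ap F m [v, v, y] = ap F e [y, y]" if A: "v \<in> A" "y \<in> A" for v y
  proof -
    define M where "M = (\<lambda>x. ap F e [x, y]) ` A"
    have MA: "M \<subseteq> A" using eA A by (auto simp: M_def)
    have eM: "ap F e [x, y] = x" if "x \<in> M" for x using that idem A by (auto simp: M_def)
    have "(\<lambda>z. ap F q [v, z, y]) ` M \<subseteq> M" using q0A A MA by (auto simp: q M_def)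
    moreover have "inj_on (\<lambda>z. ap F q [v, z, y]) M"
    proof (rule inj_onI)
      fix x x' assume x: "x \<in> M" "x' \<in> M" and eq: "ap F q [v, x, y] = ap F q [v, x', y]"
      show "x = x'" using q2[OF eq] x MA A eM by (simp add: subset_iff)
    qed
    moreover have "ap F e [y, y] \<in> M" using A by (simp add: M_def)
    ultimately show ?thesis
      using funpow_fact_inverse(1)[of M "\<lambda>z. ap F q [v, z, y]" "card A" "ap F e [y, y]"]
        MA finite_subset[OF MA fin] card_mono[OF fin MA] by (simp add: m l N_def)
  qed
  show thesis
  proof (rule that[OF wfe wfm wfn par _ _ _ nonconst min])
    fix u v y assume A: "u \<in> A" "v \<in> A" "y \<in> A"
    show "ap F m [u, v, y] = ap F e [y, y]" if "ap F e [u, y] = ap F e [v, y]"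
      using mm[of v y] qe[of u y] qe[of v y] A that by (metis m)
    define M where "M = (\<lambda>x. ap F e [x, y]) ` A"
    have MA: "M \<subseteq> A" using eA A by (auto simp: M_def)
    have eM: "ap F e [x, y] = x" if "x \<in> M" for x using that idem A by (auto simp: M_def)
    let ?h = "\<lambda>x. ap F q [x, ap F l [v, y], y]"
    have "?h ` M \<subseteq> M" using q0A A MA lA by (auto simp: q M_def)
    moreover have "inj_on ?h M"
    proof (rule inj_onI)
      fix x x' assume x: "x \<in> M" "x' \<in> M" and eq: "?h x = ?h x'"
      show "x = x'" using q1[OF eq] x MA A eM lA by (simp add: subset_iff)
    qed
    moreover have "ap F e [u, y] \<in> M" using A by (simp add: M_def)
    ultimately have "(?h ^^ (N - 1)) (?h (ap F e [u, y])) = ap F e [u, y]"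
      using funpow_fact_inverse(2)[of M ?h "card A" "ap F e [u, y]"]
        MA finite_subset[OF MA fin] card_mono[OF fin MA] by (simp add: N_def)
    then show "ap F n [ap F m [u, v, y], v, y] = ap F e [u, y]"
      using qe A by (simp add: n m)
    show "ap F e [ap F m [u, v, y], y] = ap F m [u, v, y]"
      unfolding m q using idem q0A lA A by simp
  qed
qed

end

text \<open>\<open>e(x; y)\<close> is a retraction onto a minimal set through \<open>e(y; y)\<close>. For different \<open>y\<close>
  these minimal sets are parallel. On each of them \<open>m(u, v; y)\<close> serves as the difference
  of \<open>u\<close> and \<open>v\<close>, with zero element \<open>e(y; y)\<close>, and \<open>n\<close> as the corresponding sum.\<close>

locale abelian_pair = ss_pair ar A F B G
  for ar :: "'f \<Rightarrow> nat" and A :: "'a set" and F and B :: "'b set" and G +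
  fixes e m n :: "('f, nat) trm"
  assumes tc: A.term_condition
    and wf: "wf_trm ar e" "wf_trm ar m" "wf_trm ar n"
    and par: "\<And>x y z. x \<in> A \<Longrightarrow> y \<in> A \<Longrightarrow> z \<in> A \<Longrightarrow> ap F e [ap F e [x, y], z] = ap F e [x, z]"
    and diff: "\<And>u v y. u \<in> A \<Longrightarrow> v \<in> A \<Longrightarrow> y \<in> A \<Longrightarrow> ap F e [u, y] = ap F e [v, y] \<Longrightarrow>
      ap F m [u, v, y] = ap F e [y, y]"
    and inv: "\<And>u v y. u \<in> A \<Longrightarrow> v \<in> A \<Longrightarrow> y \<in> A \<Longrightarrow> ap F n [ap F m [u, v, y], v, y] = ap F e [u, y]"
    and em: "\<And>u v y. u \<in> A \<Longrightarrow> v \<in> A \<Longrightarrow> y \<in> A \<Longrightarrow> ap F e [ap F m [u, v, y], y] = ap F m [u, v, y]"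
    and nonconst: "\<And>y. y \<in> A \<Longrightarrow> \<exists>x\<in>A. \<exists>x'\<in>A. ap F e [x, y] \<noteq> ap F e [x', y]"
    and min: "\<And>\<phi> x x' y. \<phi> \<in> A.pol1 \<Longrightarrow> x \<in> A \<Longrightarrow> x' \<in> A \<Longrightarrow> y \<in> A \<Longrightarrow>
      \<phi> (ap F e [x, y]) \<noteq> \<phi> (ap F e [x', y]) \<Longrightarrow> inj_on \<phi> ((\<lambda>x. ap F e [x, y]) ` A)"
begin

section \<open>Laws of retraction and difference in both algebras\<close>

lemma closed:
  assumes "wf_trm ar t"
  shows "x \<in> A \<Longrightarrow> ap F t [x] \<in> A" "x \<in> A \<Longrightarrow> y \<in> A \<Longrightarrow> ap F t [x, y] \<in> A"
    "x \<in> A \<Longrightarrow> y \<in> A \<Longrightarrow> z \<in> A \<Longrightarrow> ap F t [x, y, z] \<in> A"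
  using assms by (auto intro: A.ap_closed)

lemma closedB:
  assumes "wf_trm ar t"
  shows "x \<in> B \<Longrightarrow> ap G t [x] \<in> B" "x \<in> B \<Longrightarrow> y \<in> B \<Longrightarrow> ap G t [x, y] \<in> B"
    "x \<in> B \<Longrightarrow> y \<in> B \<Longrightarrow> z \<in> B \<Longrightarrow> ap G t [x, y, z] \<in> B"
  using assms by (auto intro: B.ap_closed)

lemma parB:
  assumes "x \<in> B" "y \<in> B" "z \<in> B"
  shows "ap G e [ap G e [x, y], z] = ap G e [x, z]"
  using transfer3[of "sub [sub [Var 0, Var 1] e, Var 2] e" "sub [Var 0, Var 2] e" x y z] wf par assms by simp

lemma diffB:
  assumes "u \<in> B" "y \<in> B"
  shows "ap G m [u, u, y] = ap G e [y, y]"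
  using transfer2[of "sub [Var 0, Var 0, Var 1] m" "sub [Var 1, Var 1] e" u y] wf diff assms by simp

lemma invB:
  assumes "u \<in> B" "v \<in> B" "y \<in> B"
  shows "ap G n [ap G m [u, v, y], v, y] = ap G e [u, y]"
  using transfer3[of "sub [m, Var 1, Var 2] n" "sub [Var 0, Var 2] e" u v y] wf inv assms by simp

text \<open>The zero is also the difference of \<open>v\<close> with itself, and adding
  \<open>v\<close> back by \<open>n\<close> recovers the retracts of \<open>u\<close> and
  \<open>v\<close>.\<close>

lemma difference_eq: "u \<in> A \<Longrightarrow> v \<in> A \<Longrightarrow> y \<in> A \<Longrightarrow> ap F m [u, v, y] = ap F e [y, y] \<Longrightarrow>
    ap F e [u, y] = ap F e [v, y]"
  using inv[of u v y] inv[of v v y] diff[of v v y] by simp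

lemma difference_eqB: "u \<in> B \<Longrightarrow> v \<in> B \<Longrightarrow> y \<in> B \<Longrightarrow> ap G m [u, v, y] = ap G e [y, y] \<Longrightarrow>
    ap G e [u, y] = ap G e [v, y]"
  using invB[of u v y] invB[of v v y] diffB[of v y] by simp

text \<open>By \<open>parB\<close>, constancy for one \<open>y\<close> spreads to all parameters and
  becomes an identity, which would then hold in \<open>A\<close>.\<close>

lemma nonconstB:
  assumes "y \<in> B"
  shows "\<exists>x\<in>B. \<exists>x'\<in>B. ap G e [x, y] \<noteq> ap G e [x', y]"
proof (rule ccontr)
  assume neg: "\<not> ?thesis"
  have *: "ap G (sub [Var 0, Var 2] e) [x, x', z] = ap G (sub [Var 1, Var 2] e) [x, x', z]"
    if "x \<in> B" "x' \<in> B" "z \<in> B" for x x' z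
  proof -
    have "ap G e [x, z] = ap G e [x', z]"
      using parB[of x y z] parB[of x' y z] neg that assms by metis
    then show ?thesis by simp
  qed
  obtain a where a: "a \<in> A" by (rule A.two)
  then obtain x x' where x: "x \<in> A" "x' \<in> A" "ap F e [x, a] \<noteq> ap F e [x', a]" using nonconst by blast
  have "ap F (sub [Var 0, Var 2] e) [x, x', a] = ap F (sub [Var 1, Var 2] e) [x, x', a]"
    by (rule ss_pair.transfer3[OF swap _ _ * x(1,2) a]) (simp_all add: wf)
  with x(3) show False by simp
qed

text \<open>The pairs whose difference vanishes on the range of \<open>\<sigma>\<close>. By
  \<open>par\<close> any parameter in \<open>e\<close> gives the same relation; choosing
  \<open>y\<close> keeps the equation unary.\<close>

definition zero_pairs :: "('f, nat) trm \<Rightarrow> (('f, nat) trm \<times> ('f, nat) trm) set" where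
  "zero_pairs \<sigma> = {(s, t). wf_trm ar s \<and> wf_trm ar t \<and>
    (\<forall>y\<in>A. ap F e [ap F s [ap F \<sigma> [y]], y] = ap F e [ap F t [ap F \<sigma> [y]], y])}"

definition flat :: "('f, nat) trm \<Rightarrow> bool" where
  "flat \<sigma> \<longleftrightarrow> wf_trm ar \<sigma> \<and> (\<forall>s t. wf_trm ar s \<longrightarrow> wf_trm ar t \<longrightarrow> (\<forall>y\<in>A. \<forall>y'\<in>A. \<forall>z\<in>A.
    ap F m [ap F s [ap F \<sigma> [y]], ap F t [ap F \<sigma> [y]], z] =
    ap F m [ap F s [ap F \<sigma> [y']], ap F t [ap F \<sigma> [y']], z]))"

text \<open>If the difference of \<open>s\<close> and \<open>t\<close> varies on the range of \<open>\<sigma>\<close>, then it varies along the image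
  of a minimal set under a polynomial. Since it permutes that minimal set, whatever the
  parameters, a term can solve for the point of this line where the difference vanishes.\<close>

lemma kill_pair:
  assumes \<sigma>: "wf_trm ar \<sigma>" and st: "wf_trm ar s" "wf_trm ar t" and y01: "y0 \<in> A" "y1 \<in> A" and z: "z \<in> A"
    and ne: "ap F m [ap F s [ap F \<sigma> [y0]], ap F t [ap F \<sigma> [y0]], z] \<noteq>
      ap F m [ap F s [ap F \<sigma> [y1]], ap F t [ap F \<sigma> [y1]], z]"
  shows "\<exists>\<sigma>'. wf_trm ar \<sigma>' \<and> zero_pairs \<sigma> \<subset> zero_pairs \<sigma>'"
proof -
  define \<chi> where "\<chi> y = ap F m [ap F s [ap F \<sigma> [y]], ap F t [ap F \<sigma> [y]], z]" for y
  obtain a b where ab: "a \<in> A" "b \<in> A" "a \<noteq> b" by (rule A.two)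
  obtain c c' where c: "c \<in> A" "c' \<in> A" "ap F e [c, z] \<noteq> ap F e [c', z]" using nonconst[OF z] by blast
  define x x' where "x = ap F e [c, z]" and "x' = ap F e [c', z]"
  have x: "x \<in> A" "x' \<in> A" "x \<noteq> x'" "ap F e [x, z] = x" "ap F e [x', z] = x'"
    using c z wf closed par by (auto simp: x_def x'_def)
  obtain g0 where g0: "g0 \<in> A.pol1" "\<chi> (g0 x) \<noteq> \<chi> (g0 x')"
    using A.separate[of x x' y0 y1 \<chi>] x y01 ne by (auto simp: \<chi>_def)
  obtain g where g: "wf_trm ar g" "\<And>x. g0 x = ap F g [x, a, b]"
    using A.pol1_term[OF A.gens_pair g0(1)] ab by metis
  define H where "H = sub [sub [sub [Var 0, Var 1] e, Var 2, Var 3] g] \<sigma>"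
  have H: "ap F H [x, y, u, v] = ap F \<sigma> [ap F g [ap F e [x, y], u, v]]" for x y u v
    by (simp add: H_def)
  define \<Psi> where "\<Psi> = sub [sub [H] s, sub [H] t, Var 1] m"
  have \<Psi>: "ap F \<Psi> [x, y, u, v] = ap F m [ap F s [ap F H [x, y, u, v]], ap F t [ap F H [x, y, u, v]], y]" for x y u v
    by (simp add: \<Psi>_def)
  have wfH: "wf_trm ar H" and wf\<Psi>: "wf_trm ar \<Psi>"
    using wf g st \<sigma> by (simp_all add: H_def \<Psi>_def)
  \<comment> \<open>The term condition moves the dependence on \<open>x\<close> from the parameters
    \<open>z, a, b\<close> to \<open>y, y, y\<close>, leaving \<open>y\<close> as the only
    parameter.\<close>
  have ne\<Psi>: "ap F \<Psi> [x, y, y, y] \<noteq> ap F \<Psi> [x', y, y, y]" if "y \<in> A" for y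
  proof
    assume "ap F \<Psi> [x, y, y, y] = ap F \<Psi> [x', y, y, y]"
    then have "ap F \<Psi> [x, z, a, b] = ap F \<Psi> [x', z, a, b]"
      using A.term_conditionD[OF tc wf\<Psi> x(1,2), of "[y, y, y]" "[z, a, b]"] that z ab by simp
    with g0(2) show False using x by (simp add: \<Psi> H g(2) \<chi>_def)
  qed
  define N :: nat where "N = fact (card A)"
  \<comment> \<open>The inverse power of \<open>\<Psi>(-, y, y, y)\<close> on the minimal set,
    applied to the zero \<open>e(y, y)\<close>, gives the point where the difference
    vanishes.\<close>
  define k where "k = sub [sub [Var 0, Var 0] e, Var 0, Var 0, Var 0] (itr 4 \<Psi> (N - 1))"
  have wfk: "wf_trm ar k" using wf wf\<Psi> by (simp add: k_def)
  define \<gamma> where "\<gamma> = sub [sub [k, Var 0] e, Var 0, Var 0] g"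
  have wf\<gamma>: "wf_trm ar \<gamma>" using wf wfk g by (simp add: \<gamma>_def)
  \<comment> \<open>As \<open>\<sigma>'\<close> factors through \<open>\<sigma>\<close>, no zero
    pair is lost; \<open>(s, t)\<close> is gained.\<close>
  define \<sigma>' where "\<sigma>' = sub [\<gamma>] \<sigma>"
  have wf\<sigma>': "wf_trm ar \<sigma>'" using wf\<gamma> \<sigma> by (simp add: \<sigma>'_def)
  have \<sigma>': "ap F \<sigma>' [y] = ap F \<sigma> [ap F \<gamma> [y]]" for y by (simp add: \<sigma>'_def)
  have k: "ap F \<Psi> [ap F k [y], y, y, y] = ap F e [y, y]" if y: "y \<in> A" for y
  proof -
    define M where "M = (\<lambda>x. ap F e [x, y]) ` A"
    have MA: "M \<subseteq> A" using y wf closed by (auto simp: M_def)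
    have \<Psi>A: "ap F \<Psi> [x, y, y, y] \<in> A" if "x \<in> A" for x
      using that y wf\<Psi> by (intro A.ap_closed) auto
    have HA: "ap F H [x, y, y, y] \<in> A" if "x \<in> A" for x
      using that y wfH by (intro A.ap_closed) auto
    let ?h = "\<lambda>x. ap F \<Psi> [x, y, y, y]"
    have e\<Psi>: "?h x = ap F e [?h x, y]" if "x \<in> A" for x
      using em HA[OF that] closed(1) st y by (simp add: \<Psi>)
    have im: "?h ` M \<subseteq> M"
    proof (rule image_subsetI)
      fix x assume "x \<in> M"
      then have "x \<in> A" using MA by blast
      from e\<Psi>[OF this] \<Psi>A[OF this] show "?h x \<in> M" unfolding M_def by (rule image_eqI)
    qed
    have \<Psi>e: "?h (ap F e [v, y]) = ?h v" if "v \<in> A" for v using par that y by (simp add: \<Psi> H)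
    have "?h \<in> A.pol1" using A.pol1_ap[OF wf\<Psi>, of "[y, y, y]"] y by simp
    then have "inj_on ?h M" unfolding M_def
      using min[of ?h x x' y] ne\<Psi>[OF y] x y \<Psi>e by simp
    moreover have "ap F e [y, y] \<in> M" using y by (simp add: M_def)
    moreover have "ap F k [y] = (?h ^^ (N - 1)) (ap F e [y, y])" by (simp add: k_def)
    ultimately show ?thesis
      using funpow_fact_inverse(1)[of M ?h "card A" "ap F e [y, y]"] im
        finite_subset[OF MA A.fin] card_mono[OF A.fin MA] by (simp add: N_def)
  qed
  have "(s, t) \<in> zero_pairs \<sigma>'"
    unfolding zero_pairs_def
  proof (clarsimp simp: st)
    fix y assume y: "y \<in> A"
    have "ap F m [ap F s [ap F \<sigma>' [y]], ap F t [ap F \<sigma>' [y]], y] = ap F e [y, y]"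
      using k[OF y] by (simp add: \<Psi> H \<sigma>' \<gamma>_def)
    then show "ap F e [ap F s [ap F \<sigma>' [y]], y] = ap F e [ap F t [ap F \<sigma>' [y]], y]"
      using y closed(1) st wf\<sigma>' by (intro difference_eq) auto
  qed
  moreover have "(s, t) \<notin> zero_pairs \<sigma>"
  proof
    assume "(s, t) \<in> zero_pairs \<sigma>"
    then have "ap F e [ap F s [ap F \<sigma> [y]], y] = ap F e [ap F t [ap F \<sigma> [y]], y]" if "y \<in> A" for y
      using that by (auto simp: zero_pairs_def)
    then have "ap F e [ap F s [ap F \<sigma> [y]], z] = ap F e [ap F t [ap F \<sigma> [y]], z]" if "y \<in> A" for y
      using par[of "ap F s [ap F \<sigma> [y]]" y z] par[of "ap F t [ap F \<sigma> [y]]" y z] that z closed(1) st \<sigma> by simp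
    then have "\<chi> y = ap F e [z, z]" if "y \<in> A" for y
      unfolding \<chi>_def using that z closed(1) st \<sigma> by (intro diff) auto
    with ne y01 show False by (simp add: \<chi>_def)
  qed
  moreover have "zero_pairs \<sigma> \<subseteq> zero_pairs \<sigma>'"
  proof
    fix r assume "r \<in> zero_pairs \<sigma>"
    then obtain s' t' where r: "r = (s', t')" "wf_trm ar s'" "wf_trm ar t'"
      and eq: "\<And>y. y \<in> A \<Longrightarrow> ap F e [ap F s' [ap F \<sigma> [y]], y] = ap F e [ap F t' [ap F \<sigma> [y]], y]"
      by (auto simp: zero_pairs_def)
    have "ap F e [ap F s' [ap F \<sigma>' [y]], y] = ap F e [ap F t' [ap F \<sigma>' [y]], y]" if y: "y \<in> A" for y
    proof -
      define w where "w = ap F \<gamma> [y]"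
      have w: "w \<in> A" using y wf\<gamma> closed(1) by (simp add: w_def)
      show ?thesis
        using eq[OF w] par[of "ap F s' [ap F \<sigma> [w]]" w y] par[of "ap F t' [ap F \<sigma> [w]]" w y]
          w y closed(1) r \<sigma> by (simp add: \<sigma>' w_def[symmetric])
    qed
    then show "r \<in> zero_pairs \<sigma>'" using r by (simp add: zero_pairs_def)
  qed
  ultimately show ?thesis using wf\<sigma>' by blast
qed

text \<open>\<open>zero_pairs \<sigma>\<close> depends only on the map that \<open>\<sigma>\<close>
  induces on the finite set \<open>A\<close>. So a maximal one exists, and by
  \<open>kill_pair\<close> its \<open>\<sigma>\<close> is flat.\<close>

lemma flat_exists: "\<exists>\<sigma>. flat \<sigma>"
proof -
  let ?Z = "\<lambda>f. {(s, t). wf_trm ar s \<and> wf_trm ar t \<and>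
    (\<forall>y\<in>A. ap F e [ap F s [f y], y] = ap F e [ap F t [f y], y])}"
  define ZZ where "ZZ = zero_pairs ` {\<sigma>. wf_trm ar \<sigma>}"
  have "ZZ \<subseteq> ?Z ` (A \<rightarrow>\<^sub>E A)"
  proof
    fix Z assume "Z \<in> ZZ"
    then obtain \<sigma> where \<sigma>: "wf_trm ar \<sigma>" "Z = zero_pairs \<sigma>" by (auto simp: ZZ_def)
    then have "Z = ?Z (restrict (\<lambda>y. ap F \<sigma> [y]) A)" by (auto simp: zero_pairs_def)
    moreover have "restrict (\<lambda>y. ap F \<sigma> [y]) A \<in> A \<rightarrow>\<^sub>E A" using closed(1) \<sigma> by auto
    ultimately show "Z \<in> ?Z ` (A \<rightarrow>\<^sub>E A)" by blast
  qed
  then have "finite ZZ" by (rule finite_subset) (simp add: finite_PiE)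
  moreover have "zero_pairs (Var 0) \<in> ZZ" by (simp add: ZZ_def)
  ultimately obtain Z where "Z \<in> ZZ" and max: "\<And>Z'. Z' \<in> ZZ \<Longrightarrow> Z \<subseteq> Z' \<Longrightarrow> Z = Z'"
    using finite_has_maximal[of ZZ] by blast
  then obtain \<sigma> where \<sigma>: "wf_trm ar \<sigma>" "Z = zero_pairs \<sigma>" by (auto simp: ZZ_def)
  have "\<not> zero_pairs \<sigma> \<subset> zero_pairs \<sigma>'" if "wf_trm ar \<sigma>'" for \<sigma>'
    using max[of "zero_pairs \<sigma>'"] \<sigma>(2) that by (simp add: ZZ_def psubset_eq)
  then have "flat \<sigma>" unfolding flat_def
  proof (intro conjI allI impI ballI \<sigma>(1), goal_cases)
    case (1 s t y y' z)
    show ?case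
    proof (rule ccontr)
      assume "\<not> ?case"
      from kill_pair[OF \<sigma>(1) 1(2-6) this] 1(1) show False by blast
    qed
  qed
  then show ?thesis by blast
qed

lemma flatD:
  assumes "flat \<sigma>" "wf_trm ar s" "wf_trm ar t" "y \<in> A" "y' \<in> A" "z \<in> A"
  shows "ap F m [ap F s [ap F \<sigma> [y]], ap F t [ap F \<sigma> [y]], z] =
    ap F m [ap F s [ap F \<sigma> [y']], ap F t [ap F \<sigma> [y']], z]"
  using assms(1)[unfolded flat_def, THEN conjunct2, rule_format, OF assms(2-6)] .

lemma flatB:
  assumes "flat \<sigma>" "wf_trm ar s" "wf_trm ar t" "y \<in> B" "y' \<in> B" "z \<in> B"
  shows "ap G m [ap G s [ap G \<sigma> [y]], ap G t [ap G \<sigma> [y]], z] =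
    ap G m [ap G s [ap G \<sigma> [y']], ap G t [ap G \<sigma> [y']], z]"
proof -
  let ?d = "\<lambda>v. sub [sub [sub [v] \<sigma>] s, sub [sub [v] \<sigma>] t, Var 2] m"
  have wf\<sigma>: "wf_trm ar \<sigma>" using assms(1) by (simp add: flat_def)
  have *: "ap F (?d (Var 0)) [y, y', z] = ap F (?d (Var 1)) [y, y', z]"
    if "y \<in> A" "y' \<in> A" "z \<in> A" for y y' z
  proof -
    have "ap F m [ap F s [ap F \<sigma> [y]], ap F t [ap F \<sigma> [y]], z] =
      ap F m [ap F s [ap F \<sigma> [y']], ap F t [ap F \<sigma> [y']], z]"
      using flatD[OF assms(1-3) that] .
    then show ?thesis by simp
  qed
  have "ap G (?d (Var 0)) [y, y', z] = ap G (?d (Var 1)) [y, y', z]"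
    by (rule transfer3[OF _ _ * assms(4-6)]) (simp_all add: assms(2,3) wf wf\<sigma>)
  then show ?thesis by simp
qed

text \<open>A constant difference that vanishes at one point of the range vanishes everywhere; this
  is a one-variable identity of \<open>A\<close> and passes to \<open>B\<close>.\<close>

lemma flat_zero:
  assumes \<sigma>: "flat \<sigma>" and st: "wf_trm ar s" "wf_trm ar t"
    and y0: "y0 \<in> A" "ap F s [ap F \<sigma> [y0]] = ap F t [ap F \<sigma> [y0]]" and y: "y \<in> B"
  shows "ap G e [ap G s [ap G \<sigma> [y]], y] = ap G e [ap G t [ap G \<sigma> [y]], y]"
proof -
  have wf\<sigma>: "wf_trm ar \<sigma>" using \<sigma> by (simp add: flat_def)
  have "ap F e [ap F s [ap F \<sigma> [y]], y] = ap F e [ap F t [ap F \<sigma> [y]], y]" if "y \<in> A" for y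
  proof (rule difference_eq)
    have "ap F m [ap F s [ap F \<sigma> [y]], ap F t [ap F \<sigma> [y]], y] =
      ap F m [ap F s [ap F \<sigma> [y0]], ap F t [ap F \<sigma> [y0]], y]"
      using flatD[OF \<sigma> st that y0(1) that] .
    also have "\<dots> = ap F e [y, y]" using y0 that st closed(1) wf\<sigma> by (intro diff) auto
    finally show "ap F m [ap F s [ap F \<sigma> [y]], ap F t [ap F \<sigma> [y]], y] = ap F e [y, y]" .
  qed (use that st wf\<sigma> closed(1) in auto)
  then have "ap G (sub [sub [\<sigma>] s, Var 0] e) [y] = ap G (sub [sub [\<sigma>] t, Var 0] e) [y]"
    using st wf wf\<sigma> y by (intro transfer1) auto
  then show ?thesis by simp
qed

section \<open>Isomorphisms in the abelian case\<close>

lemma separateB: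
  assumes "B.gens gs" "u \<in> B" "v \<in> B" "u \<noteq> v" "y \<in> B"
  shows "\<exists>g. wf_trm ar g \<and> ap G e [ap G g (u # gs), y] \<noteq> ap G e [ap G g (v # gs), y]"
proof -
  obtain x x' where "x \<in> B" "x' \<in> B" "ap G e [x, y] \<noteq> ap G e [x', y]" using nonconstB assms by blast
  then obtain g where "g \<in> B.pol1" "ap G e [g u, y] \<noteq> ap G e [g v, y]"
    using B.separate[of u v x x' "\<lambda>x. ap G e [x, y]"] assms by blast
  then show ?thesis using B.pol1_term[OF assms(1)] by metis
qed

lemma separateA:
  assumes "A.gens gs" "u \<in> A" "v \<in> A" "u \<noteq> v" "y \<in> A"
  shows "\<exists>g. wf_trm ar g \<and> ap F e [ap F g (u # gs), y] \<noteq> ap F e [ap F g (v # gs), y]"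
proof -
  obtain x x' where "x \<in> A" "x' \<in> A" "ap F e [x, y] \<noteq> ap F e [x', y]" using nonconst assms by blast
  then obtain g where "g \<in> A.pol1" "ap F e [g u, y] \<noteq> ap F e [g v, y]"
    using A.separate[of u v x x' "\<lambda>x. ap F e [x, y]"] assms by blast
  then show ?thesis using A.pol1_term[OF assms(1)] by metis
qed

text \<open>Here the single elements \<open>\<sigma>(a0)\<close> and \<open>\<sigma>(b0)\<close>
  generate. If \<open>s\<close> and \<open>t\<close> agree at the first, so do \<open>g(s)\<close>
  and \<open>g(t)\<close> for every term \<open>g\<close>, and by \<open>flat_zero\<close> no
  \<open>g\<close> separates them at the second.\<close>

lemma isomorphic_no_triv:
  assumes nA: "\<And>x. \<not> A.triv x" and nB: "\<And>x. \<not> B.triv x"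
  shows "isomorphic_alg ar A F B G"
proof -
  obtain \<sigma> where \<sigma>: "flat \<sigma>" using flat_exists by blast
  then have wf\<sigma>: "wf_trm ar \<sigma>" by (simp add: flat_def)
  obtain a0 where a0: "a0 \<in> A" by (rule A.two)
  obtain b0 where b0: "b0 \<in> B" by (rule B.two)
  define a b where "a = ap F \<sigma> [a0]" and "b = ap G \<sigma> [b0]"
  have ab: "a \<in> A" "b \<in> B" using a0 b0 closed(1) closedB(1) wf\<sigma> by (auto simp: a_def b_def)
  have gB: "B.gens [b]" using B.gens_single ab nB by blast
  show ?thesis
  proof (rule isomorphic_of_gens[OF A.gens_single[OF ab(1) nA] gB])
    fix s t assume st: "wf_trm ar s" "wf_trm ar t" and eq: "ap F s [a] = ap F t [a]"
    show "ap G s [b] = ap G t [b]"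
    proof (rule ccontr)
      assume "ap G s [b] \<noteq> ap G t [b]"
      then obtain g where g: "wf_trm ar g" "ap G e [ap G g [ap G s [b], b], b0] \<noteq> ap G e [ap G g [ap G t [b], b], b0]"
        using separateB[OF gB, of "ap G s [b]" "ap G t [b]" b0] st ab b0 closedB(1) by blast
      have "ap G e [ap G (sub [s, Var 0] g) [b], b0] = ap G e [ap G (sub [t, Var 0] g) [b], b0]"
        unfolding b_def using st g eq a0 b0 by (intro flat_zero[OF \<sigma>, of _ _ a0]) (auto simp: a_def)
      with g(2) show False by simp
    qed
  qed
qed

text \<open>All unary terms, \<open>\<sigma>\<close> included, fix \<open>z\<close>, so any two of
  them agree at a point of its range. By \<open>flat_zero\<close> no term distinguishes
  \<open>G f (replicate (ar f) b)\<close> from \<open>b\<close>.\<close>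

lemma triv_transfer:
  assumes z: "A.triv z"
  shows "\<exists>x. B.triv x"
proof (rule ccontr)
  assume nB: "\<not> ?thesis"
  obtain \<sigma> where \<sigma>: "flat \<sigma>" using flat_exists by blast
  then have wf\<sigma>: "wf_trm ar \<sigma>" by (simp add: flat_def)
  have zA: "z \<in> A" using z by (simp add: A.triv_def)
  obtain b0 where b0: "b0 \<in> B" by (rule B.two)
  define b where "b = ap G \<sigma> [b0]"
  have b: "b \<in> B" using b0 closedB(1) wf\<sigma> by (simp add: b_def)
  have gB: "B.gens [b]" using B.gens_single b nB by blast
  obtain f where f: "G f (replicate (ar f) b) \<noteq> b" using nB b by (auto simp: B.triv_def)
  define s :: "('f, nat) trm" where "s = Op f (replicate (ar f) (Var 0))"
  have s: "wf_trm ar s" "ap G s [b] \<noteq> b" using f by (simp_all add: s_def ap_def)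
  then obtain g where g: "wf_trm ar g" "ap G e [ap G g [ap G s [b], b], b0] \<noteq> ap G e [ap G g [b, b], b0]"
    using separateB[OF gB, of "ap G s [b]" b b0] b b0 closedB(1) by blast
  have triv: "ap F t [z] = z" if "wf_trm ar t" for t using A.triv_ap[OF z that] by simp
  have "ap G e [ap G (sub [s, Var 0] g) [b], b0] = ap G e [ap G (sub [Var 0, Var 0] g) [b], b0]"
    unfolding b_def using s(1) g(1) zA b0 wf\<sigma>
    by (intro flat_zero[OF \<sigma>, of _ _ z]) (simp_all add: triv)
  with g(2) show False by simp
qed

text \<open>Here flatness is transferred first: in \<open>B\<close> the constant difference is zero
  because it is zero at \<open>z\<close>, and this identity returns to \<open>A\<close>.\<close>

lemma triv_transfer':
  assumes z: "B.triv z"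
  shows "\<exists>x. A.triv x"
proof (rule ccontr)
  assume nA: "\<not> ?thesis"
  obtain \<sigma> where \<sigma>: "flat \<sigma>" using flat_exists by blast
  then have wf\<sigma>: "wf_trm ar \<sigma>" by (simp add: flat_def)
  have zB: "z \<in> B" using z by (simp add: B.triv_def)
  obtain a0 where a0: "a0 \<in> A" by (rule A.two)
  define a where "a = ap F \<sigma> [a0]"
  have a: "a \<in> A" using a0 closed(1) wf\<sigma> by (simp add: a_def)
  have gA: "A.gens [a]" using A.gens_single a nA by blast
  obtain f where f: "F f (replicate (ar f) a) \<noteq> a" using nA a by (auto simp: A.triv_def)
  define s :: "('f, nat) trm" where "s = Op f (replicate (ar f) (Var 0))"
  have s: "wf_trm ar s" "ap F s [a] \<noteq> a" using f by (simp_all add: s_def ap_def)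
  then obtain g where g: "wf_trm ar g" "ap F e [ap F g [ap F s [a], a], a0] \<noteq> ap F e [ap F g [a, a], a0]"
    using separateA[OF gA, of "ap F s [a]" a a0] a a0 closed(1) by blast
  define p q where "p = sub [s, Var 0] g" and "q = sub [Var 0, Var 0] g"
  have pq: "wf_trm ar p" "wf_trm ar q" using s g by (simp_all add: p_def q_def)
  have triv: "ap G t [z] = z" if "wf_trm ar t" for t using B.triv_ap[OF z that] by simp
  have "ap G m [ap G p [ap G \<sigma> [y]], ap G q [ap G \<sigma> [y]], x] = ap G e [x, x]" if "x \<in> B" "y \<in> B" for x y
    using flatB[OF \<sigma> pq that(2) zB that(1)] triv pq wf\<sigma> diffB zB that by simp
  then have "ap F (sub [sub [sub [Var 0] \<sigma>] p, sub [sub [Var 0] \<sigma>] q, Var 1] m) [a0, a0] = ap F (sub [Var 1, Var 1] e) [a0, a0]"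
    using pq wf wf\<sigma> a0 by (intro ss_pair.transfer2[OF swap]) auto
  then have "ap F m [ap F p [a], ap F q [a], a0] = ap F e [a0, a0]" by (simp add: a_def)
  then have "ap F e [ap F p [a], a0] = ap F e [ap F q [a], a0]"
    using a a0 pq closed(1) by (intro difference_eq) auto
  with g(2) show False by (simp add: p_def q_def)
qed

lemma isomorphic_triv:
  assumes z: "A.triv z" and z': "B.triv z'"
  shows "isomorphic_alg ar A F B G"
proof -
  have zA: "z \<in> A" and zB: "z' \<in> B" using z z' by (simp_all add: A.triv_def B.triv_def)
  have tA: "ap F t [z] = z" "ap F t [z, z] = z" "ap F t [z, z, z] = z" if "wf_trm ar t" for t
    using A.triv_ap[OF z that] by simp_all
  have tB: "ap G t [z'] = z'" "ap G t [z', z'] = z'" "ap G t [z', z', z'] = z'" if "wf_trm ar t" for t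
    using B.triv_ap[OF z' that] by simp_all
  obtain a where a: "a \<in> A" "a \<noteq> z" "ap F e [a, z] = a"
    using nonconst[OF zA] par[of _ z z] zA closed(2)[OF wf(1)] by metis
  obtain b where b: "b \<in> B" "b \<noteq> z'" "ap G e [b, z'] = b"
    using nonconstB[OF zB] parB[of _ z' z'] zB closedB(2)[OF wf(1)] by metis
  have gA: "A.gens [a, z]" using A.gens_pair a zA by blast
  have gB: "B.gens [b, z']" using B.gens_pair b zB by blast
  show ?thesis
  proof (rule isomorphic_of_gens[OF gA gB])
    fix s t assume st: "wf_trm ar s" "wf_trm ar t" and eq: "ap F s [a, z] = ap F t [a, z]"
    show "ap G s [b, z'] = ap G t [b, z']"
    proof (rule ccontr)
      assume "ap G s [b, z'] \<noteq> ap G t [b, z']"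
      then obtain g where g: "wf_trm ar g"
        "ap G e [ap G g [ap G s [b, z'], b, z'], z'] \<noteq> ap G e [ap G g [ap G t [b, z'], b, z'], z']"
        using separateB[OF gB, of "ap G s [b, z']" "ap G t [b, z']" z'] st b zB closedB(2) by blast
      define p q where "p = sub [s, Var 0, Var 1] g" and "q = sub [t, Var 0, Var 1] g"
      have pq: "wf_trm ar p" "wf_trm ar q" using st g by (simp_all add: p_def q_def)
      \<comment> \<open>The difference of \<open>p\<close> and \<open>q\<close> along the minimal
        set. For parameter \<open>z\<close> it vanishes at \<open>a\<close> and at \<open>z\<close>,
        so by minimality it is constant; by the term condition it is constant for every parameter,
        and this identity passes to \<open>B\<close>.\<close>
      define D where "D = sub [sub [e, Var 1] p, sub [e, Var 1] q, Var 1] m"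
      have wfD: "wf_trm ar D" using wf pq by (simp add: D_def)
      have D: "ap H D [x, y] = ap H m [ap H p [ap H e [x, y], y], ap H q [ap H e [x, y], y], y]"
        for H :: "'f \<Rightarrow> 'c list \<Rightarrow> 'c" and x y by (simp add: D_def)
      have "ap F p [a, z] = ap F q [a, z]" using eq by (simp add: p_def q_def)
      then have Da: "ap F D [a, z] = z"
        using diff[of "ap F q [a, z]" "ap F q [a, z]" z] a zA pq closed(2) tA(2)[OF wf(1)] by (simp add: D)
      let ?h = "\<lambda>x. ap F D [x, z]"
      have h: "?h \<in> A.pol1" using A.pol1_ap[OF wfD, of "[z]"] zA by simp
      have const: "ap F D [x, z] = ap F D [x', z]" if x: "x \<in> A" "x' \<in> A" for x x'
      proof (rule ccontr)
        assume "ap F D [x, z] \<noteq> ap F D [x', z]"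
        then have "inj_on ?h ((\<lambda>x. ap F e [x, z]) ` A)"
          using min[OF h x zA] par[of _ z z] x zA by (simp add: D)
        moreover have "a \<in> (\<lambda>x. ap F e [x, z]) ` A" "z \<in> (\<lambda>x. ap F e [x, z]) ` A"
          using a tA(2)[OF wf(1)] zA by (metis image_eqI)+
        moreover have "?h a = ?h z" using Da tA(2)[OF wfD] by simp
        ultimately show False using a(2) by (meson inj_onD)
      qed
      have *: "ap F (sub [Var 0, Var 2] D) [x, x', y] = ap F (sub [Var 1, Var 2] D) [x, x', y]"
        if "x \<in> A" "x' \<in> A" "y \<in> A" for x x' y
      proof -
        have "ap F D [x, y] = ap F D [x', y]"
          using A.term_conditionD[OF tc wfD that(1,2), of "[z]" "[y]"] const[OF that(1,2)] that zA by simp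
        then show ?thesis by simp
      qed
      have "ap G (sub [Var 0, Var 2] D) [b, z', z'] = ap G (sub [Var 1, Var 2] D) [b, z', z']"
        by (rule transfer3[OF _ _ * b(1) zB zB]) (simp_all add: wfD)
      then have "ap G D [b, z'] = ap G e [z', z']" using tB(2)[OF wfD] tB(2)[OF wf(1)] by simp
      then have "ap G e [ap G p [b, z'], z'] = ap G e [ap G q [b, z'], z']"
        using b zB pq closedB(2) by (intro difference_eqB) (auto simp: D)
      with g(2) show False by (simp add: p_def q_def)
    qed
  qed
qed

lemma isomorphic: "isomorphic_alg ar A F B G"
proof (cases "\<exists>x. A.triv x")
  case True
  then show ?thesis using triv_transfer isomorphic_triv by metis
next
  case False
  then show ?thesis using triv_transfer' isomorphic_no_triv by metis
qed

end

section \<open>The two cases combined\<close>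

context ss_pair
begin

lemma isomorphic_sym: "isomorphic_alg ar B G A F \<Longrightarrow> isomorphic_alg ar A F B G"
proof -
  assume "isomorphic_alg ar B G A F"
  then obtain h where h: "bij_betw h B A"
    and hom: "\<And>f xs. length xs = ar f \<Longrightarrow> set xs \<subseteq> B \<Longrightarrow> h (G f xs) = F f (map h xs)"
    unfolding isomorphic_alg_def by blast
  let ?k = "the_inv_into B h"
  have k: "bij_betw ?k A B" using h by (rule bij_betw_the_inv_into)
  have inj: "inj_on h B" and hB: "h ` B = A" using h by (simp_all add: bij_betw_def)
  have "?k (F f xs) = G f (map ?k xs)" if "length xs = ar f" "set xs \<subseteq> A" for f xs
  proof -
    have ys: "set (map ?k xs) \<subseteq> B" using k that by (auto simp: bij_betw_def)
    have "map h (map ?k xs) = xs"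
      using that f_the_inv_into_f[OF inj] hB by (auto intro!: map_idI)
    then have "h (G f (map ?k xs)) = F f xs" using hom[of "map ?k xs" f] ys that by simp
    moreover have "G f (map ?k xs) \<in> B" using B.alg[of "map ?k xs" f] ys that by simp
    ultimately show ?thesis using the_inv_into_f_f[OF inj] by metis
  qed
  with k show ?thesis unfolding isomorphic_alg_def by blast
qed

text \<open>The maximal set is chosen among those of both algebras; whichever it belongs to plays
  the role of \<open>A\<close> in \<open>isomorphic_of_maximal_config\<close>.\<close>

lemma isomorphic_of_config:
  assumes "(\<exists>c d e p u. A.config c d e p u) \<or> (\<exists>c d e p u. B.config c d e p u)"
  shows "isomorphic_alg ar A F B G"
proof -
  define TA where "TA = {A.unit_terms c d e u |c d e p u. A.config c d e p u}"
  define TB where "TB = {B.unit_terms c d e u |c d e p u. B.config c d e p u}"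
  have "finite (TA \<union> TB)" "TA \<union> TB \<noteq> {}"
    using A.finite_unit_terms B.finite_unit_terms assms by (auto simp: TA_def TB_def)
  then obtain T where T: "T \<in> TA \<union> TB" and max: "\<And>T'. T' \<in> TA \<union> TB \<Longrightarrow> T \<subseteq> T' \<Longrightarrow> T = T'"
    using finite_has_maximal[of "TA \<union> TB"] by blast
  from T show ?thesis
  proof
    assume "T \<in> TA"
    then obtain c d e p u where T: "T = A.unit_terms c d e u" and cfg: "A.config c d e p u"
      by (auto simp: TA_def)
    show ?thesis
    proof (rule isomorphic_of_maximal_config[OF cfg])
      fix c' d' e' p' u' assume "B.config c' d' e' p' u'"
      then have "B.unit_terms c' d' e' u' \<in> TA \<union> TB" unfolding TB_def by blast
      from max[OF this] show "A.unit_terms c d e u = B.unit_terms c' d' e' u'"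
        if "A.unit_terms c d e u \<subseteq> B.unit_terms c' d' e' u'" using that T by simp
    qed
  next
    assume "T \<in> TB"
    then obtain c d e p u where T: "T = B.unit_terms c d e u" and cfg: "B.config c d e p u"
      by (auto simp: TB_def)
    have "isomorphic_alg ar B G A F"
    proof (rule ss_pair.isomorphic_of_maximal_config[OF swap cfg])
      fix c' d' e' p' u' assume "A.config c' d' e' p' u'"
      then have "A.unit_terms c' d' e' u' \<in> TA \<union> TB" unfolding TA_def by blast
      from max[OF this] show "B.unit_terms c d e u = A.unit_terms c' d' e' u'"
        if "B.unit_terms c d e u \<subseteq> A.unit_terms c' d' e' u'" using that T by simp
    qed
    then show ?thesis by (rule isomorphic_sym)
  qed
qed

lemma isomorphic_of_not_strongly_abelian:
  assumes "\<not> strongly_abelian ar A F"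
  shows "isomorphic_alg ar A F B G"
proof -
  obtain U \<epsilon> where U: "A.minset U \<epsilon>" using A.minset_exists by blast
  show ?thesis
  proof (cases "A.mixed U")
    case True
    then show ?thesis using A.mixed_config[OF U] isomorphic_of_config by blast
  next
    case False
    have lat: "A.latin U" by (rule A.unmixed_latin[OF U False assms])
    have tc: "A.term_condition" by (rule A.unmixed_term_condition[OF U False lat])
    show ?thesis
    proof (rule A.difference_terms[OF U lat tc], goal_cases)
      case (1 e m n)
      interpret abelian_pair ar A F B G e m n
        by unfold_locales (fact tc | fact 1)+
      show ?case by (rule isomorphic)
    qed
  qed
qed

end

theorem theorem3p1:
  fixes ar :: "'f \<Rightarrow> nat"
    and A :: "'a set" and F :: "'f \<Rightarrow> 'a list \<Rightarrow> 'a"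
    and B :: "'b set" and G :: "'f \<Rightarrow> 'b list \<Rightarrow> 'b"
  assumes "strictly_simple ar A F"
    and "strictly_simple ar B G"
    and "same_variety ar A F B G"
  shows "isomorphic_alg ar A F B G \<or> (strongly_abelian ar A F \<and> strongly_abelian ar B G)"
proof -
  interpret ss_pair ar A F B G
    using assms by unfold_locales
  show ?thesis
    using isomorphic_of_not_strongly_abelian isomorphic_sym
      ss_pair.isomorphic_of_not_strongly_abelian[OF swap] by blast
qed

end
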